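(* Let $I\subseteq\mathbb{R}$ be an interval, $G:I\to(0,1)$ a continuous strictly increasing bijection, and $X,X_1,X_2,\ldots$ i.i.d. with law $P$, $P(I)=1$. Put $U=G(X)$, $U_i=G(X_i)$; for a fixed integer $q\ge2$ and $1\le r,s\le q$ let $p_r=\mathbb{E}[U^r]$, $\widehat p_r=\frac1n\sum_{i=1}^nU_i^r$, $\mathbf p_q=(p_1,\ldots,p_q)^\top$, $\widehat{\mathbf p}_q=(\widehat p_1,\ldots,\widehat p_q)^\top$, $(\Sigma_q)_{rs}=\operatorname{Cov}(U^r,U^s)$ and $(\widehat\Sigma_q)_{rs}=\frac1{n-1}\sum_{i=1}^n(U_i^r-\widehat p_r)(U_i^s-\widehat p_s)$. Let $h_q$ be the polynomial map from $(p_1,\ldots,p_q)$ to the vector of a selection of centred coordinate moments of orders between $2$ and $q$, let $H_q$ be its Jacobian at $\mathbf p_q$ and $\widehat H_q$ its Jacobian at $\widehat{\mathbf p}_q$. Then, as $n\to\infty$, $$\sqrt n\{h_q(\widehat{\mathbf p}_q)-h_q(\mathbf p_q)\}\rightsquigarrow\mathcal N(0,H_q\Sigma_qH_q^\top),$$ and $\widehat H_q\widehat\Sigma_q\widehat H_q^\top\to H_q\Sigma_qH_q^\top$ in probability.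
   Context: The centred coordinate moment of order $r\ge2$ is $\mu_{r,c}=\mathbb{E}[(U-p_1)^r]=\sum_{j=0}^r\binom rj(-p_1)^{r-j}p_j$ with $p_0=1$; $h_q$ is given componentwise by the right-hand side, as a polynomial in $(p_1,\ldots,p_q)$, for the selected orders $r$. Normal laws may be degenerate. *)

theory Defs
  imports "HOL-Probability.Probability"
begin

(* A function given only on the interval I is extended by 0.  When X lies in I almost surely,
   transform G I \<circ> X is G(X) up to a null event, and it is a random variable whatever values
   the term G takes outside I. *)
definition transform :: "(real \<Rightarrow> real) \<Rightarrow> real set \<Rightarrow> real \<Rightarrow> real"
  where "transform G I x = (if x \<in> I then G x else 0)"

(* Coordinates of R^q are indexed by a type 'q together with a labelling ord, a bijection from 'q
   onto {1..q}: the component at i carries the moment of order ord i. *)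

definition moment_vec :: "'a measure \<Rightarrow> ('q::finite \<Rightarrow> nat) \<Rightarrow> ('a \<Rightarrow> real) \<Rightarrow> real ^ 'q"
  where "moment_vec M ord U = (\<chi> i. \<integral>\<omega>. U \<omega> ^ ord i \<partial>M)"

definition sample_moment_vec ::
    "('q::finite \<Rightarrow> nat) \<Rightarrow> (nat \<Rightarrow> 'a \<Rightarrow> real) \<Rightarrow> nat \<Rightarrow> 'a \<Rightarrow> real ^ 'q"
  where "sample_moment_vec ord U n \<omega> = (\<chi> i. 1 / real n * (\<Sum>k=1..n. U k \<omega> ^ ord i))"

definition covariance :: "'a measure \<Rightarrow> ('a \<Rightarrow> real) \<Rightarrow> ('a \<Rightarrow> real) \<Rightarrow> real"
  where "covariance M Y Z =
    (\<integral>\<omega>. (Y \<omega> - (\<integral>\<omega>'. Y \<omega>' \<partial>M)) * (Z \<omega> - (\<integral>\<omega>'. Z \<omega>' \<partial>M)) \<partial>M)"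

definition moment_cov :: "'a measure \<Rightarrow> ('q::finite \<Rightarrow> nat) \<Rightarrow> ('a \<Rightarrow> real) \<Rightarrow> real ^ 'q ^ 'q"
  where "moment_cov M ord U =
    (\<chi> i j. covariance M (\<lambda>\<omega>. U \<omega> ^ ord i) (\<lambda>\<omega>. U \<omega> ^ ord j))"

definition sample_moment_cov ::
    "('q::finite \<Rightarrow> nat) \<Rightarrow> (nat \<Rightarrow> 'a \<Rightarrow> real) \<Rightarrow> nat \<Rightarrow> 'a \<Rightarrow> real ^ 'q ^ 'q"
  where "sample_moment_cov ord U n \<omega> =
    (\<chi> i j. 1 / (real n - 1) *
       (\<Sum>k=1..n. (U k \<omega> ^ ord i - sample_moment_vec ord U n \<omega> $ i)
               * (U k \<omega> ^ ord j - sample_moment_vec ord U n \<omega> $ j)))"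

(* p_j for 0 \<le> j \<le> q, with the convention p_0 = 1. *)
definition moment_coord :: "('q::finite \<Rightarrow> nat) \<Rightarrow> real ^ 'q \<Rightarrow> nat \<Rightarrow> real"
  where "moment_coord ord p j = (if j = 0 then 1 else p $ inv ord j)"

(* The map h_q for the selection (c k), k :: 'k, of orders.  If p is the vector of raw moments
   of U, the k-th component is the binomial expansion of E[(U - p_1)^(c k)]. *)
definition centred_moments ::
    "('q::finite \<Rightarrow> nat) \<Rightarrow> ('k::finite \<Rightarrow> nat) \<Rightarrow> real ^ 'q \<Rightarrow> real ^ 'k"
  where "centred_moments ord c p =
    (\<chi> k. \<Sum>j=0..c k. real (c k choose j) * (- moment_coord ord p 1) ^ (c k - j)
                      * moment_coord ord p j)"

(* The second argument is the variance; variance 0 gives the point mass at m. *)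
definition normal_law :: "real \<Rightarrow> real \<Rightarrow> real measure"
  where "normal_law m v =
    (if v > 0 then density lborel (\<lambda>x. ennreal (normal_density m (sqrt v) x)) else return borel m)"

(* N is the possibly degenerate normal law N(m, S): every linear functional is univariate normal
   with the corresponding mean and variance. *)
definition is_normal :: "(real ^ 'k::finite) measure \<Rightarrow> real ^ 'k \<Rightarrow> real ^ 'k ^ 'k \<Rightarrow> bool"
  where "is_normal N m S \<longleftrightarrow>
    sets N = sets borel \<and> transpose S = S \<and> (\<forall>t. 0 \<le> t \<bullet> (S *v t)) \<and>
    (\<forall>t. distr N borel (\<lambda>x. t \<bullet> x) = normal_law (t \<bullet> m) (t \<bullet> (S *v t)))"

(* The library's weak_conv_m covers only laws on the real line. *)
definition converges_in_law ::
    "'a measure \<Rightarrow> (nat \<Rightarrow> 'a \<Rightarrow> 'b::metric_space) \<Rightarrow> 'b measure \<Rightarrow> bool"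
  where "converges_in_law M Y N \<longleftrightarrow>
    (\<forall>f::'b \<Rightarrow> real. continuous_on UNIV f \<longrightarrow> bounded (range f) \<longrightarrow>
       (\<lambda>n. \<integral>x. f x \<partial>(distr M borel (Y n))) \<longlonglongrightarrow> (\<integral>x. f x \<partial>N))"

definition converges_in_prob ::
    "'a measure \<Rightarrow> (nat \<Rightarrow> 'a \<Rightarrow> 'b::metric_space) \<Rightarrow> 'b \<Rightarrow> bool"
  where "converges_in_prob M Y l \<longleftrightarrow>
    (\<forall>\<epsilon>>0. (\<lambda>n. measure M {\<omega> \<in> space M. dist (Y n \<omega>) l > \<epsilon>}) \<longlonglongrightarrow> 0)"

end

theory Submission
  imports Defs
begin

text \<open>
  The delta method reduces the first claim to the multivariate central limit theorem for the bounded
  i.i.d. vectors \<open>(U\<^sub>k, \<dots>, U\<^sub>k\<^sup>q)\<close>: the mean squared error of the sample mean is \<open>O(1/n)\<close>, hence the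
  linearisation error of \<open>h\<close>, scaled by \<open>\<surd>n\<close>, tends to \<open>0\<close> in \<open>L\<^sup>1\<close> and does not affect the limit of the
  characteristic functions; along each direction that limit is given by the univariate central limit theorem.

  Weak convergence in \<open>\<real>\<^sup>k\<close> follows from convergence of characteristic functions, provided that the
  limit is known to be a probability measure. Integrals of Gaussian functions are averages of the
  characteristic function; by Stone-Weierstrass, finite combinations of Gaussian functions are uniformly
  dense in the compactly supported continuous functions; and the mass of the limit law prevents
  escape of mass to infinity. The limit law is the linear image of a standard Gaussian vector under a
  factor \<open>A\<close> of the covariance matrix \<open>A A\<^sup>T\<close>.

  The second claim is the weak law of large numbers for \<open>U\<^sup>r\<close> and \<open>U\<^sup>r U\<^sup>s\<close>, followed by continuous mapping.
\<close>

section \<open>A continuity theorem for characteristic functions in Euclidean space\<close>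

text \<open>Encoded as the image of a finite product of one-dimensional laws, so that integrals of
  products over the coordinates factorise.\<close>

definition std_gaussian :: "'b::euclidean_space measure"
  where "std_gaussian =
    distr (\<Pi>\<^sub>M b\<in>Basis. std_normal_distribution) borel (\<lambda>g. \<Sum>b\<in>Basis. g b *\<^sub>R b)"

lemma measurable_std_gaussian_coord [measurable]:
  "(\<lambda>g. \<Sum>b\<in>Basis. g b *\<^sub>R b) \<in> (\<Pi>\<^sub>M b\<in>(Basis :: 'b::euclidean_space set). std_normal_distribution) \<rightarrow>\<^sub>M borel"
proof -
  have "(\<lambda>g. g b) \<in> borel_measurable (\<Pi>\<^sub>M b\<in>(Basis :: 'b set). std_normal_distribution)" if "b \<in> Basis" for b
    using measurable_component_singleton[OF that, of "\<lambda>_. std_normal_distribution"]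
    by (simp cong: measurable_cong_sets)
  then show ?thesis
    by (intro borel_measurable_sum borel_measurable_scaleR borel_measurable_const) auto
qed

lemma prob_space_std_gaussian: "prob_space (std_gaussian :: 'b::euclidean_space measure)"
  unfolding std_gaussian_def
  by (intro prob_space.prob_space_distr prob_space_PiM prob_space_normal_density measurable_std_gaussian_coord)
    simp

lemma sets_std_gaussian [measurable_cong, simp]: "sets std_gaussian = sets borel"
  by (simp add: std_gaussian_def)

lemma space_std_gaussian [simp]: "space std_gaussian = UNIV"
  by (simp add: std_gaussian_def)

text \<open>The exponential of the inner product splits into a product over \<open>Basis\<close>,
  and Fubini reduces it to one-dimensional characteristic functions. The exponents add up to the
  squared norm.\<close>

lemma char_std_gaussian:
  fixes t :: "'b::euclidean_space"
  shows "(CLINT x|std_gaussian. iexp (t \<bullet> x)) = exp (- (norm t)\<^sup>2 / 2)"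
proof -
  interpret product_sigma_finite "\<lambda>_::'b. std_normal_distribution"
    by (intro product_sigma_finite.intro prob_space_imp_sigma_finite prob_space_normal_density) simp
  interpret N: real_distribution std_normal_distribution
    by (rule real_dist_normal_dist)
  have "(CLINT x|std_gaussian. iexp (t \<bullet> x)) =
      (CLINT g|(\<Pi>\<^sub>M b\<in>(Basis :: 'b set). std_normal_distribution). iexp (t \<bullet> (\<Sum>b\<in>Basis. g b *\<^sub>R b)))"
    unfolding std_gaussian_def by (rule integral_distr) measurable
  also have "\<dots> = (CLINT g|(\<Pi>\<^sub>M b\<in>(Basis :: 'b set). std_normal_distribution).
      (\<Prod>b\<in>Basis. iexp ((t \<bullet> b) * g b)))"
    by (simp add: exp_sum[symmetric] inner_sum_right sum_distrib_left mult_ac)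
  also have "\<dots> = (\<Prod>b\<in>Basis. CLINT x|std_normal_distribution. iexp ((t \<bullet> b) * x))"
    by (rule product_integral_prod) (auto intro!: N.integrable_iexp)
  also have "\<dots> = (\<Prod>b\<in>Basis. of_real (exp (- (t \<bullet> b)\<^sup>2 / 2)))"
    using char_std_normal_distribution by (simp add: char_def fun_eq_iff)
  also have "\<dots> = of_real (exp (\<Sum>b\<in>Basis. - (t \<bullet> b)\<^sup>2 / 2))"
    by (simp add: exp_sum)
  also have "(\<Sum>b\<in>Basis. - (t \<bullet> b)\<^sup>2 / 2) = - (norm t)\<^sup>2 / 2"
    by (simp add: sum_negf sum_divide_distrib[symmetric] euclidean_inner[of t t] power2_eq_square
        power2_norm_eq_inner[unfolded power2_eq_square])
  finally show ?thesis by simp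
qed

text \<open>A Gaussian is itself the characteristic function of a Gaussian law, so its integral against \<open>\<mu>\<close> is,
  by Fubini, an average of the characteristic function of \<open>\<mu>\<close>.\<close>

lemma gaussian_integral_eq_char:
  fixes \<mu> :: "'b::euclidean_space measure"
  assumes "prob_space \<mu>" and sets: "sets \<mu> = sets borel"
  shows "complex_of_real (\<integral>x. exp (- (norm (s *\<^sub>R (x - a)))\<^sup>2 / 2) \<partial>\<mu>) =
    (CLINT y|std_gaussian. iexp (- (s *\<^sub>R y) \<bullet> a) * (CLINT x|\<mu>. iexp ((s *\<^sub>R y) \<bullet> x)))"
proof -
  interpret \<mu>: prob_space \<mu> by fact
  interpret \<gamma>: prob_space "std_gaussian :: 'b measure" by (rule prob_space_std_gaussian)
  interpret P: pair_prob_space \<mu> "std_gaussian :: 'b measure" ..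
  note [measurable_cong] = sets
  have "complex_of_real (\<integral>x. exp (- (norm (s *\<^sub>R (x - a)))\<^sup>2 / 2) \<partial>\<mu>) =
      (CLINT x|\<mu>. (CLINT y|std_gaussian. iexp ((s *\<^sub>R (x - a)) \<bullet> y)))"
    by (simp only: char_std_gaussian integral_complex_of_real)
  also have "\<dots> = (CLINT y|std_gaussian. (CLINT x|\<mu>. iexp ((s *\<^sub>R (x - a)) \<bullet> y)))"
    by (rule P.Fubini_integral[symmetric], rule P.integrable_const_bound[where B=1]) auto
  also have "\<dots> = (CLINT y|std_gaussian. (CLINT x|\<mu>. iexp (- (s *\<^sub>R y) \<bullet> a) * iexp ((s *\<^sub>R y) \<bullet> x)))"
    by (simp add: inner_diff_left algebra_simps inner_commute flip: exp_add)
  finally show ?thesis by simp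
qed

text \<open>In the averaging identity the law enters only through its characteristic function, which
  has modulus at most 1. Hence pointwise convergence suffices, by dominated convergence with the
  constant 1.\<close>

lemma gaussian_integral_tendsto:
  fixes \<mu> :: "nat \<Rightarrow> 'b::euclidean_space measure"
  assumes \<mu>: "\<And>n. prob_space (\<mu> n)" "\<And>n. sets (\<mu> n) = sets borel"
    and \<nu>: "prob_space \<nu>" "sets \<nu> = sets borel"
    and char: "\<And>t. (\<lambda>n. CLINT x|\<mu> n. iexp (t \<bullet> x)) \<longlonglongrightarrow> (CLINT x|\<nu>. iexp (t \<bullet> x))"
  shows "(\<lambda>n. \<integral>x. exp (- (norm (s *\<^sub>R (x - a)))\<^sup>2 / 2) \<partial>\<mu> n)
    \<longlonglongrightarrow> (\<integral>x. exp (- (norm (s *\<^sub>R (x - a)))\<^sup>2 / 2) \<partial>\<nu>)"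
proof -
  interpret \<gamma>: prob_space "std_gaussian :: 'b measure" by (rule prob_space_std_gaussian)
  have meas: "(\<lambda>y. CLINT x|m. iexp ((s *\<^sub>R y) \<bullet> x)) \<in> borel_measurable borel"
    if "prob_space m" "sets m = sets borel" for m :: "'b measure"
  proof -
    interpret m: prob_space m by fact
    note [measurable_cong] = that(2)
    show ?thesis by measurable
  qed
  have bound: "norm (CLINT x|m. iexp (t \<bullet> x)) \<le> 1" if "prob_space m" for m :: "'b measure" and t
  proof -
    interpret m: prob_space m by fact
    show ?thesis
      using integral_norm_bound[of m "\<lambda>x. iexp (t \<bullet> x)"] by (simp add: m.prob_space)
  qed
  have "(\<lambda>n. CLINT y|std_gaussian. iexp (- (s *\<^sub>R y) \<bullet> a) * (CLINT x|\<mu> n. iexp ((s *\<^sub>R y) \<bullet> x)))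
    \<longlonglongrightarrow> (CLINT y|std_gaussian. iexp (- (s *\<^sub>R y) \<bullet> a) * (CLINT x|\<nu>. iexp ((s *\<^sub>R y) \<bullet> x)))"
  proof (rule integral_dominated_convergence[where w="\<lambda>_. 1"])
    show "AE y in std_gaussian. (\<lambda>n. iexp (- (s *\<^sub>R y) \<bullet> a) * (CLINT x|\<mu> n. iexp ((s *\<^sub>R y) \<bullet> x)))
        \<longlonglongrightarrow> iexp (- (s *\<^sub>R y) \<bullet> a) * (CLINT x|\<nu>. iexp ((s *\<^sub>R y) \<bullet> x))"
      by (intro AE_I2 tendsto_mult tendsto_const char)
    show "AE y in std_gaussian. norm (iexp (- (s *\<^sub>R y) \<bullet> a) * (CLINT x|\<mu> n. iexp ((s *\<^sub>R y) \<bullet> x))) \<le> 1" for n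
      using bound[OF \<mu>(1)[of n]] by (intro AE_I2) (simp add: norm_mult del: inner_scaleR_left)
  qed (use meas[OF \<mu>] meas[OF \<nu>] in measurable)
  then show ?thesis
    unfolding gaussian_integral_eq_char[OF \<mu>, symmetric] gaussian_integral_eq_char[OF \<nu>, symmetric]
    by (rule tendsto_of_real_iff[THEN iffD1])
qed

text \<open>The side condition admits integrable Gaussians and, for \<open>m = 0\<close>, constants only: these terms are
  bounded and closed under multiplication.\<close>

inductive gaussian_comb :: "('b::euclidean_space \<Rightarrow> real) \<Rightarrow> bool" where
  zero: "gaussian_comb (\<lambda>_. 0)"
| add_term: "gaussian_comb f \<Longrightarrow> m > 0 \<or> m = 0 \<and> b = 0 \<Longrightarrow>
    gaussian_comb (\<lambda>x. f x + c * exp (b \<bullet> x - m * (norm x)\<^sup>2))"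

section \<open>Closure properties and integrals of Gaussian combinations\<close>

lemma gaussian_comb_term:
  "m > 0 \<or> m = 0 \<and> b = 0 \<Longrightarrow> gaussian_comb (\<lambda>x. c * exp (b \<bullet> x - m * (norm x)\<^sup>2))"
  using add_term[OF zero, of m b c] by simp

lemma gaussian_comb_const: "gaussian_comb (\<lambda>_. c)"
  using gaussian_comb_term[of 0 0 c] by simp

lemma gaussian_comb_add:
  assumes "gaussian_comb f" and "gaussian_comb g"
  shows "gaussian_comb (\<lambda>x. f x + g x)"
  using assms(2) by induction (auto simp: assms(1) add.assoc[symmetric] intro: add_term)

text \<open>Multiplying two terms adds their parameters. The side condition survives: a sum of
  nonnegative \<open>m\<close> vanishes only if both do, and then both \<open>b\<close> are
  0.\<close>

lemma gaussian_comb_mult_term: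
  assumes "gaussian_comb f" and m: "m > 0 \<or> m = 0 \<and> b = 0"
  shows "gaussian_comb (\<lambda>x. f x * (c * exp (b \<bullet> x - m * (norm x)\<^sup>2)))"
  using assms(1)
proof induction
  case (add_term f m' b' c')
  then have "m' + m > 0 \<or> m' + m = 0 \<and> b' + b = 0" using m by auto
  from gaussian_comb_add[OF add_term.IH gaussian_comb_term[OF this, of "c' * c"]]
  show ?case by (simp add: algebra_simps exp_add exp_diff)
qed (simp add: zero)

lemma gaussian_comb_mult:
  assumes "gaussian_comb f" and "gaussian_comb g"
  shows "gaussian_comb (\<lambda>x. f x * g x)"
  using assms(2)
proof induction
  case (add_term g m b c)
  from gaussian_comb_add[OF add_term.IH gaussian_comb_mult_term[OF assms(1) add_term(2), of c]]
  show ?case by (simp add: algebra_simps)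
qed (simp add: zero)

lemma gaussian_comb_sum:
  assumes "\<And>i. i \<in> A \<Longrightarrow> gaussian_comb (f i)"
  shows "gaussian_comb (\<lambda>x. \<Sum>i\<in>A. f i x)"
  using assms by (induction A rule: infinite_finite_induct) (auto intro: zero gaussian_comb_add)

text \<open>Completing the square brings a term into the form of
  \<open>gaussian_integral_tendsto\<close>, with centre \<open>b / (2 * m)\<close> and scale
  \<open>sqrt (2 * m)\<close>. The factor in front is the maximum of the term.\<close>

lemma exp_complete_square:
  fixes b x :: "'b::real_inner"
  assumes "m > 0"
  shows "exp (b \<bullet> x - m * (norm x)\<^sup>2) = exp ((norm b)\<^sup>2 / (4 * m)) *
    exp (- (norm (sqrt (2 * m) *\<^sub>R (x - (1 / (2 * m)) *\<^sub>R b)))\<^sup>2 / 2)"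
proof -
  have "(norm (x - (1 / (2 * m)) *\<^sub>R b))\<^sup>2 = (norm x)\<^sup>2 - (b \<bullet> x) / m + (norm b)\<^sup>2 / (4 * m\<^sup>2)"
  proof -
    have "(norm (x - c *\<^sub>R b))\<^sup>2 = (norm x)\<^sup>2 - 2 * c * (b \<bullet> x) + c\<^sup>2 * (norm b)\<^sup>2" for c
      unfolding power2_norm_eq_inner
      by (simp add: inner_diff_left inner_diff_right inner_commute power2_eq_square algebra_simps)
    from this[of "1 / (2 * m)"] show ?thesis
      by (simp add: power_divide power_mult_distrib)
  qed
  then have "(norm (sqrt (2 * m) *\<^sub>R (x - (1 / (2 * m)) *\<^sub>R b)))\<^sup>2 =
      2 * m * ((norm x)\<^sup>2 - (b \<bullet> x) / m + (norm b)\<^sup>2 / (4 * m\<^sup>2))"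
    using assms by (simp add: power_mult_distrib)
  then show ?thesis
    using assms by (simp only: flip: exp_add) (simp add: field_simps power2_eq_square)
qed

lemma gaussian_term_le:
  fixes b x :: "'b::real_inner"
  assumes "m > 0"
  shows "exp (b \<bullet> x - m * (norm x)\<^sup>2) \<le> exp ((norm b)\<^sup>2 / (4 * m))"
  unfolding exp_complete_square[OF assms] by (rule mult_left_le) auto

lemma gaussian_comb_bounded:
  assumes "gaussian_comb f"
  shows "\<exists>B. \<forall>x. \<bar>f x\<bar> \<le> B"
  using assms
proof induction
  case (add_term f m b c)
  then obtain B where B: "\<bar>f x\<bar> \<le> B" for x by blast
  have "exp (b \<bullet> x - m * (norm x)\<^sup>2) \<le> exp ((norm b)\<^sup>2 / (4 * m))" for x
    using add_term(2) gaussian_term_le[of m b x] by auto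
  then have "\<bar>f x + c * exp (b \<bullet> x - m * (norm x)\<^sup>2)\<bar> \<le> B + \<bar>c\<bar> * exp ((norm b)\<^sup>2 / (4 * m))" for x
    by (intro order_trans[OF abs_triangle_ineq] add_mono B) (simp add: abs_mult mult_left_mono)
  then show ?case by blast
qed auto

lemma gaussian_comb_measurable: "gaussian_comb f \<Longrightarrow> f \<in> borel_measurable borel"
  by (induction rule: gaussian_comb.induct) auto

lemma gaussian_comb_integrable:
  assumes "gaussian_comb f" and "prob_space \<mu>" and "sets \<mu> = sets borel"
  shows "integrable \<mu> f"
proof -
  interpret prob_space \<mu> by fact
  from gaussian_comb_bounded[OF assms(1)] obtain B where "\<bar>f x\<bar> \<le> B" for x by blast
  then show ?thesis
    using gaussian_comb_measurable[OF assms(1)] assms(3)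
    by (intro integrable_const_bound[where B=B]) (auto cong: measurable_cong_sets)
qed

lemma gaussian_comb_integral_tendsto:
  fixes \<mu> :: "nat \<Rightarrow> 'b::euclidean_space measure"
  assumes \<mu>: "\<And>n. prob_space (\<mu> n)" "\<And>n. sets (\<mu> n) = sets borel"
    and \<nu>: "prob_space \<nu>" "sets \<nu> = sets borel"
    and char: "\<And>t. (\<lambda>n. CLINT x|\<mu> n. iexp (t \<bullet> x)) \<longlonglongrightarrow> (CLINT x|\<nu>. iexp (t \<bullet> x))"
    and "gaussian_comb f"
  shows "(\<lambda>n. \<integral>x. f x \<partial>\<mu> n) \<longlonglongrightarrow> (\<integral>x. f x \<partial>\<nu>)"
  using \<open>gaussian_comb f\<close>
proof induction
  case (add_term f m b c)
  have "(\<lambda>n. \<integral>x. exp (b \<bullet> x - m * (norm x)\<^sup>2) \<partial>\<mu> n) \<longlonglongrightarrow> (\<integral>x. exp (b \<bullet> x - m * (norm x)\<^sup>2) \<partial>\<nu>)"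
  proof (cases "m > 0")
    case True
    show ?thesis
      unfolding exp_complete_square[OF True] integral_mult_right_zero
      by (intro tendsto_mult tendsto_const gaussian_integral_tendsto \<mu> \<nu> char)
  next
    \<comment> \<open>Here \<open>m = 0\<close> and \<open>b = 0\<close>, so the integrand is the
      constant 1 and both integrals equal the total mass 1.\<close>
    case False
    then show ?thesis
      using add_term(2) \<mu>(1) \<nu>(1) by (simp add: prob_space.prob_space)
  qed
  moreover have "integrable m' f" "integrable m' (\<lambda>x. c * exp (b \<bullet> x - m * (norm x)\<^sup>2))"
    if "prob_space m'" "sets m' = sets borel" for m'
    using gaussian_comb_integrable[OF _ that] add_term(1) gaussian_comb_term[OF add_term(2)] by blast+
  ultimately show ?case
    using \<mu> \<nu> by (simp add: Bochner_Integration.integral_add tendsto_intros add_term.IH)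
qed simp

text \<open>The map from \<open>x\<close> to \<open>(v x, w x)\<close> is built from Gaussian terms
  and has values in a compact ball, although \<open>x\<close> ranges over the whole space. Since
  \<open>g\<close> factors through it as a continuous \<open>F\<close>, a polynomial close to
  \<open>F\<close> on that ball gives a uniform approximation of \<open>g\<close>, and a polynomial
  in Gaussian terms is again a Gaussian combination.\<close>

lemma gaussian_comb_dense:
  fixes g :: "'b::euclidean_space \<Rightarrow> real"
  assumes g: "continuous_on UNIV g" and R: "\<And>x. R \<le> norm x \<Longrightarrow> g x = 0" and "0 < e"
  obtains p where "gaussian_comb p" "\<And>x. \<bar>g x - p x\<bar> < e"
proof -
  define w where "w x = exp (0 \<bullet> x - 1 * (norm x)\<^sup>2)" for x :: 'b
  define v where "v x = (\<Sum>b\<in>Basis. exp (b \<bullet> x - 1 * (norm x)\<^sup>2) *\<^sub>R b)" for x :: 'b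
  \<comment> \<open>\<open>w\<close> is at least twice this value on the ball of radius
    \<open>\<bar>R\<bar>\<close>, so \<open>w x < \<delta>\<close> puts \<open>x\<close> where
    \<open>g\<close> vanishes, while the cutoff in \<open>F\<close> equals 1 inside the
    ball.\<close>
  define \<delta> where "\<delta> = exp (- \<bar>R\<bar>\<^sup>2) / 2"
  \<comment> \<open>A lower bound for \<open>exp (x \<bullet> b)\<close> whenever \<open>w x\<close>
    is at least \<open>\<delta>\<close>: it comes from the inequality of \<open>norm x\<close> with
    \<open>1 + (norm x)\<^sup>2\<close>. The logarithm is thus never clamped where \<open>x\<close>
    has to be recovered.\<close>
  define \<kappa> where "\<kappa> = exp (- 1) * \<delta>"
  have pos [simp]: "\<delta> > 0" "\<kappa> > 0" by (simp_all add: \<delta>_def \<kappa>_def)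
  \<comment> \<open>\<open>x\<close> is recovered from \<open>(v x, w x)\<close> as long as \<open>w x \<ge> \<delta>\<close>; the clamps only make \<open>F\<close> continuous everywhere.\<close>
  define F where "F = (\<lambda>y :: 'b \<times> real. max 0 (min 1 (snd y / \<delta> - 1)) *
    g (\<Sum>b\<in>Basis. ln (max \<kappa> ((fst y \<bullet> b) / max (snd y) \<delta>)) *\<^sub>R b))"
  have F: "F (v x, w x) = g x" for x
  proof (cases "w x < \<delta>")
    case True
    have "\<bar>R\<bar> \<le> norm x"
    proof (rule ccontr)
      assume "\<not> ?thesis"
      then have "(norm x)\<^sup>2 \<le> \<bar>R\<bar>\<^sup>2" by (intro power_mono) auto
      then have "exp (- \<bar>R\<bar>\<^sup>2) \<le> w x" by (simp add: w_def)
      then show False using True pos unfolding \<delta>_def by linarith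
    qed
    then have "g x = 0" by (intro R) simp
    moreover have "w x / \<delta> - 1 \<le> 0" using True by simp
    then have "max 0 (min 1 (w x / \<delta> - 1)) = 0" by linarith
    ultimately show ?thesis by (simp only: F_def fst_conv snd_conv mult_zero_left)
  next
    case False
    have "ln (max \<kappa> ((v x \<bullet> b) / max (w x) \<delta>)) = x \<bullet> b" if b: "b \<in> Basis" for b
    proof -
      have "v x \<bullet> b = exp (x \<bullet> b) * w x"
        using b by (simp add: v_def w_def inner_commute[of b] flip: exp_add)
      then have "(v x \<bullet> b) / max (w x) \<delta> = exp (x \<bullet> b)"
        using False pos by (simp add: w_def)
      moreover have "\<kappa> \<le> exp (x \<bullet> b)"
      proof -
        have "\<bar>x \<bullet> b\<bar> \<le> norm x" using b by (rule Basis_le_norm)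
        moreover have "norm x \<le> 1 + (norm x)\<^sup>2"
          using zero_le_power2[of "norm x - 1"] norm_ge_zero[of x]
          unfolding power2_diff power_one by linarith
        ultimately have "exp (- 1) * w x \<le> exp (x \<bullet> b)"
          by (simp add: w_def flip: exp_add)
        moreover have "\<kappa> \<le> exp (- 1) * w x"
          using False by (simp add: \<kappa>_def)
        ultimately show ?thesis by linarith
      qed
      ultimately show ?thesis by simp
    qed
    then have *: "(\<Sum>b\<in>Basis. ln (max \<kappa> ((v x \<bullet> b) / max (w x) \<delta>)) *\<^sub>R b) = x"
      by (simp add: euclidean_representation)
    \<comment> \<open>The value of the cutoff between 0 and 1 is immaterial where
      \<open>g x = 0\<close>; everywhere else it is exactly 1.\<close>
    show ?thesis
    proof (cases "R \<le> norm x")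
      case True
      then show ?thesis by (simp add: F_def * R)
    next
      case False
      then have "(norm x)\<^sup>2 \<le> \<bar>R\<bar>\<^sup>2" by (intro power_mono) auto
      then have "2 * \<delta> \<le> w x" by (simp add: w_def \<delta>_def)
      then have "max 0 (min 1 (w x / \<delta> - 1)) = 1" by (simp add: field_simps)
      then show ?thesis by (simp add: F_def *)
    qed
  qed
  have cont: "continuous_on UNIV F"
  proof -
    have "\<delta> \<noteq> 0" "max z \<delta> \<noteq> 0" "max \<kappa> z \<noteq> 0" for z
      using pos by linarith+
    then show ?thesis
      unfolding F_def by (intro continuous_intros continuous_on_compose2[OF g]) auto
  qed
  have bound: "(v x, w x) \<in> cball 0 (DIM('b) * exp (1 / 4) + 1)" for x
  proof -
    \<comment> \<open>The constant is the maximum of a Gaussian term with \<open>m = 1\<close> and a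
      unit vector \<open>b\<close>.\<close>
    have "\<bar>v x \<bullet> b\<bar> \<le> exp (1 / 4)" if "b \<in> Basis" for b
      using that gaussian_term_le[of 1 b x] by (simp add: v_def)
    then have "norm (v x) \<le> DIM('b) * exp (1 / 4)"
      using norm_le_l1[of "v x"] sum_mono[of Basis "\<lambda>b. \<bar>v x \<bullet> b\<bar>" "\<lambda>_. exp (1 / 4)"] by simp
    moreover have "\<bar>w x\<bar> \<le> 1" by (simp add: w_def)
    ultimately show ?thesis
      using norm_Pair_le[of "v x" "w x"] by simp
  qed
  obtain p where p: "real_polynomial_function p"
    and close: "\<And>y. y \<in> cball 0 (DIM('b) * exp (1 / 4) + 1) \<Longrightarrow> \<bar>F y - p y\<bar> < e"
    using Stone_Weierstrass_real_polynomial_function[OF compact_cball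
        continuous_on_subset[OF cont subset_UNIV] \<open>0 < e\<close>] by blast
  have "gaussian_comb (\<lambda>x. p (v x, w x))"
    using p
  proof induction
    case (linear f)
    interpret bounded_linear f by fact
    have "f (v x, w x) = (\<Sum>b\<in>Basis. f (b, 0) * exp (b \<bullet> x - 1 * (norm x)\<^sup>2)) +
        f (0, 1) * exp (0 \<bullet> x - 1 * (norm x)\<^sup>2)" for x
    proof -
      have "(v x, w x) = (\<Sum>b\<in>Basis. exp (b \<bullet> x - 1 * (norm x)\<^sup>2) *\<^sub>R (b, 0)) + w x *\<^sub>R (0, 1)"
        by (simp add: v_def prod_eq_iff fst_sum snd_sum)
      then show ?thesis
        by (simp only: add sum scaleR w_def) (simp add: mult.commute)
    qed
    then show ?case
      by (simp only:) (intro gaussian_comb_add gaussian_comb_sum gaussian_comb_term, auto)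
  qed (auto intro: gaussian_comb_const gaussian_comb_add gaussian_comb_mult)
  moreover have "\<bar>g x - p (v x, w x)\<bar> < e" for x
    using close[OF bound[of x]] by (simp add: F)
  ultimately show ?thesis by (rule that)
qed

section \<open>From compactly supported to bounded continuous test functions\<close>

lemma integral_close:
  fixes f g :: "'b \<Rightarrow> real"
  assumes "prob_space \<mu>" and "integrable \<mu> f" and "integrable \<mu> g" and "\<And>x. \<bar>f x - g x\<bar> \<le> e"
  shows "\<bar>(\<integral>x. f x \<partial>\<mu>) - (\<integral>x. g x \<partial>\<mu>)\<bar> \<le> e"
proof -
  interpret prob_space \<mu> by fact
  have "\<bar>\<integral>x. f x - g x \<partial>\<mu>\<bar> \<le> (\<integral>x. \<bar>f x - g x\<bar> \<partial>\<mu>)"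
    by (rule integral_abs_bound)
  also have "\<dots> \<le> (\<integral>x. e \<partial>\<mu>)"
    using assms by (intro integral_mono) auto
  finally show ?thesis
    using assms by (simp add: prob_space)
qed

text \<open>The approximating sequence and its limit may change with \<open>e\<close>; the
  uniformity in \<open>n\<close> permits the exchange of limits.\<close>

lemma tendsto_uniform_approx:
  fixes a :: "nat \<Rightarrow> real"
  assumes "\<And>e. 0 < e \<Longrightarrow> \<exists>b l'. b \<longlonglongrightarrow> l' \<and> (\<forall>n. \<bar>a n - b n\<bar> \<le> e) \<and> \<bar>l - l'\<bar> \<le> e"
  shows "a \<longlonglongrightarrow> l"
proof (rule LIMSEQ_I)
  fix r :: real assume "0 < r"
  with assms[of "r / 4"] obtain b l' where b: "b \<longlonglongrightarrow> l'"
    and le: "\<And>n. \<bar>a n - b n\<bar> \<le> r / 4" "\<bar>l - l'\<bar> \<le> r / 4"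
    by (metis zero_less_divide_iff zero_less_numeral)
  from LIMSEQ_D[OF b, of "r / 4"] \<open>0 < r\<close> obtain N where N: "\<And>n. n \<ge> N \<Longrightarrow> \<bar>b n - l'\<bar> < r / 4"
    by auto
  have "norm (a n - l) < r" if "n \<ge> N" for n
    using N[OF that] le(1)[of n] le(2) \<open>0 < r\<close> unfolding real_norm_def by linarith
  then show "\<exists>N. \<forall>n\<ge>N. norm (a n - l) < r" by blast
qed

text \<open>The cutoffs \<open>\<eta> k\<close> have compact support, so their integrals converge
  along with those of \<open>f * \<eta> k\<close>. The mass lost by the cutoff is therefore small
  under \<open>\<mu> n\<close> for large \<open>n\<close> as soon as it is small under
  \<open>\<nu>\<close>, and this mass controls the error made in cutting off
  \<open>f\<close>.\<close>

theorem levy_continuity_euclidean: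
  fixes \<mu> :: "nat \<Rightarrow> 'b::euclidean_space measure" and f :: "'b \<Rightarrow> real"
  assumes \<mu>: "\<And>n. prob_space (\<mu> n)" "\<And>n. sets (\<mu> n) = sets borel"
    and \<nu>: "prob_space \<nu>" "sets \<nu> = sets borel"
    and char: "\<And>t. (\<lambda>n. CLINT x|\<mu> n. iexp (t \<bullet> x)) \<longlonglongrightarrow> (CLINT x|\<nu>. iexp (t \<bullet> x))"
    and f: "continuous_on UNIV f" "bounded (range f)"
  shows "(\<lambda>n. \<integral>x. f x \<partial>\<mu> n) \<longlonglongrightarrow> (\<integral>x. f x \<partial>\<nu>)"
proof -
  have integrable: "integrable m h"
    if "prob_space m" "sets m = sets borel" "continuous_on UNIV h" "\<And>x. \<bar>h x\<bar> \<le> B"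
    for m :: "'b measure" and h :: "'b \<Rightarrow> real" and B
  proof -
    interpret prob_space m by fact
    show ?thesis
      using borel_measurable_continuous_onI[OF that(3)] that(2,4)
      by (intro integrable_const_bound[where B=B]) (auto cong: measurable_cong_sets)
  qed
  define \<eta> where "\<eta> k x = max 0 (min 1 (real k + 1 - norm x))" for k and x :: 'b
  have \<eta>_cont: "continuous_on UNIV (\<eta> k)" for k
    unfolding \<eta>_def by (intro continuous_intros)
  have \<eta>: "0 \<le> \<eta> k x" "\<eta> k x \<le> 1" for k x
    by (simp_all add: \<eta>_def)
  have \<eta>_vanish: "\<eta> k x = 0" if "real k + 1 \<le> norm x" for k x
    using that by (simp add: \<eta>_def)
  have cpt: "(\<lambda>n. \<integral>x. h x * \<eta> k x \<partial>\<mu> n) \<longlonglongrightarrow> (\<integral>x. h x * \<eta> k x \<partial>\<nu>)"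
    if h: "continuous_on UNIV h" "\<And>x. \<bar>h x\<bar> \<le> B" for h :: "'b \<Rightarrow> real" and B k
  proof (rule tendsto_uniform_approx)
    fix e :: real assume "0 < e"
    have h\<eta>: "continuous_on UNIV (\<lambda>x. h x * \<eta> k x)"
      by (intro continuous_intros h \<eta>_cont)
    have "\<bar>h x * \<eta> k x\<bar> \<le> B * 1" for x
      unfolding abs_mult by (rule mult_mono) (use h(2)[of x] \<eta>[of k x] in auto)
    note int = integrable[OF _ _ h\<eta> this]
    obtain p where p: "gaussian_comb p" "\<And>x. \<bar>h x * \<eta> k x - p x\<bar> < e"
      using gaussian_comb_dense[OF h\<eta> _ \<open>0 < e\<close>, of "real k + 1"] by (auto simp: \<eta>_vanish)
    have "\<bar>(\<integral>x. h x * \<eta> k x \<partial>m) - (\<integral>x. p x \<partial>m)\<bar> \<le> e" if "prob_space m" "sets m = sets borel" for m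
      using that by (intro integral_close int gaussian_comb_integrable p less_imp_le[OF p(2)])
    with gaussian_comb_integral_tendsto[OF \<mu> \<nu> char p(1)]
    show "\<exists>b l'. b \<longlonglongrightarrow> l' \<and> (\<forall>n. \<bar>(\<integral>x. h x * \<eta> k x \<partial>\<mu> n) - b n\<bar> \<le> e) \<and>
        \<bar>(\<integral>x. h x * \<eta> k x \<partial>\<nu>) - l'\<bar> \<le> e"
      using \<mu> \<nu> by blast
  qed
  obtain B where B: "\<bar>f x\<bar> \<le> B" for x
    using f(2) by (auto simp: bounded_iff)
  then have "0 \<le> B" by (meson abs_ge_zero order_trans)
  have int_\<eta>: "integrable m (\<eta> k)" if "prob_space m" "sets m = sets borel" for m k
    using integrable[OF that \<eta>_cont, of k 1] \<eta> by simp
  have tail: "\<bar>(\<integral>x. f x \<partial>m) - (\<integral>x. f x * \<eta> k x \<partial>m)\<bar> \<le> B * (1 - (\<integral>x. \<eta> k x \<partial>m))"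
    if m: "prob_space m" "sets m = sets borel" for m k
  proof -
    interpret m: prob_space m by fact
    have int_f: "integrable m f" by (rule integrable[OF m f(1) B])
    have "\<bar>f x * \<eta> k x\<bar> \<le> B * 1" for x
      unfolding abs_mult by (rule mult_mono) (use B[of x] \<eta>[of k x] \<open>0 \<le> B\<close> in auto)
    then have int_f\<eta>: "integrable m (\<lambda>x. f x * \<eta> k x)"
      by (intro integrable[OF m] continuous_intros f \<eta>_cont)
    have "\<bar>\<integral>x. f x - f x * \<eta> k x \<partial>m\<bar> \<le> (\<integral>x. \<bar>f x - f x * \<eta> k x\<bar> \<partial>m)"
      by (rule integral_abs_bound)
    also have "\<dots> \<le> (\<integral>x. B * (1 - \<eta> k x) \<partial>m)"
    proof (rule integral_mono)
      show "\<bar>f x - f x * \<eta> k x\<bar> \<le> B * (1 - \<eta> k x)" for x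
      proof -
        have "f x - f x * \<eta> k x = f x * (1 - \<eta> k x)" by (simp add: algebra_simps)
        then show ?thesis
          using B[of x] \<eta>[of k x] by (simp add: abs_mult mult_right_mono)
      qed
    qed (use int_f int_f\<eta> int_\<eta>[OF m] in auto)
    finally show ?thesis
      using int_f int_f\<eta> int_\<eta>[OF m] by (simp add: m.prob_space)
  qed
  interpret \<nu>: prob_space \<nu> by (rule \<nu>(1))
  have "(\<lambda>k. \<integral>x. \<eta> k x \<partial>\<nu>) \<longlonglongrightarrow> (\<integral>x. 1 \<partial>\<nu>)"
  proof (rule integral_dominated_convergence[where w="\<lambda>_. 1"])
    show "AE x in \<nu>. (\<lambda>k. \<eta> k x) \<longlonglongrightarrow> 1"
    proof (intro AE_I2 tendsto_eventually)
      fix x :: 'b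
      obtain k0 :: nat where "norm x \<le> real k0" using real_arch_simple by blast
      then show "\<forall>\<^sub>F k in sequentially. \<eta> k x = 1"
        by (intro eventually_sequentiallyI[of k0]) (simp add: \<eta>_def)
    qed
    show "\<eta> k \<in> borel_measurable \<nu>" for k
      using int_\<eta>[OF \<nu>] by (rule borel_measurable_integrable)
  qed (use \<eta> in auto)
  then have \<eta>_lim: "(\<lambda>k. \<integral>x. \<eta> k x \<partial>\<nu>) \<longlonglongrightarrow> 1" by (simp add: \<nu>.prob_space)
  show ?thesis
  proof (rule LIMSEQ_I)
    fix r :: real assume "0 < r"
    \<comment> \<open>The summand 1 covers \<open>B = 0\<close>. The tail under \<open>\<nu>\<close>
      is then at most \<open>r / 4\<close>, the tail under \<open>\<mu> n\<close> at most
      \<open>r / 4 + r / 8\<close>, and the cut-off integrals differ by less than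
      \<open>r / 8\<close>.\<close>
    define e where "e = r / (4 * (B + 1))"
    have "0 < e" using \<open>0 < r\<close> \<open>0 \<le> B\<close> by (simp add: e_def)
    have Be: "B * e \<le> r / 4" using \<open>0 < r\<close> \<open>0 \<le> B\<close> by (simp add: e_def field_simps)
    from LIMSEQ_D[OF \<eta>_lim \<open>0 < e\<close>] obtain k where k: "\<bar>(\<integral>x. \<eta> k x \<partial>\<nu>) - 1\<bar> < e"
      by (auto simp: real_norm_def)
    \<comment> \<open>The instance \<open>h = 1\<close> of \<open>cpt\<close> transfers the tail
      bound from \<open>\<nu>\<close> to \<open>\<mu> n\<close>.\<close>
    have "(\<lambda>n. B * (1 - (\<integral>x. \<eta> k x \<partial>\<mu> n))) \<longlonglongrightarrow> B * (1 - (\<integral>x. \<eta> k x \<partial>\<nu>))"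
      using cpt[of "\<lambda>_. 1" 1 k] by (intro tendsto_intros) auto
    from LIMSEQ_D[OF this, of "r / 8"] \<open>0 < r\<close> obtain N1 where N1:
      "\<And>n. n \<ge> N1 \<Longrightarrow> \<bar>B * (1 - (\<integral>x. \<eta> k x \<partial>\<mu> n)) - B * (1 - (\<integral>x. \<eta> k x \<partial>\<nu>))\<bar> < r / 8"
      by (auto simp: real_norm_def)
    from LIMSEQ_D[OF cpt[OF f(1) B], of "r / 8" k] \<open>0 < r\<close> obtain N2 where N2:
      "\<And>n. n \<ge> N2 \<Longrightarrow> \<bar>(\<integral>x. f x * \<eta> k x \<partial>\<mu> n) - (\<integral>x. f x * \<eta> k x \<partial>\<nu>)\<bar> < r / 8"
      by (auto simp: real_norm_def)
    have "B * (1 - (\<integral>x. \<eta> k x \<partial>\<nu>)) \<le> B * e"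
      using k \<open>0 \<le> B\<close> by (intro mult_left_mono) auto
    then have "\<bar>(\<integral>x. f x \<partial>\<mu> n) - (\<integral>x. f x \<partial>\<nu>)\<bar> < r" if "n \<ge> max N1 N2" for n
      using N1[of n] N2[of n] that tail[OF \<mu>, of n k] tail[OF \<nu>, of k] Be \<open>0 < r\<close>
      unfolding max.bounded_iff by linarith
    then show "\<exists>N. \<forall>n\<ge>N. norm ((\<integral>x. f x \<partial>\<mu> n) - (\<integral>x. f x \<partial>\<nu>)) < r"
      unfolding real_norm_def by blast
  qed
qed

section \<open>Degenerate multivariate normal laws\<close>

text \<open>Gaussian elimination: subtracting \<open>(S e\<^sub>i) (S e\<^sub>i)\<^sup>T / S\<^sub>i\<^sub>i\<close> clears the \<open>i\<close>-th diagonal entry and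
  keeps \<open>S\<close> positive semidefinite. The condition on the columns of \<open>A\<close> leaves column \<open>i\<close> free for the
  vector that was split off.\<close>

lemma psd_factorization_aux:
  fixes S :: "real ^ 'n ^ 'n"
  assumes "transpose S = S" and "\<And>t. 0 \<le> t \<bullet> (S *v t)"
  shows "\<exists>A :: real ^ 'n ^ 'n. S = A ** transpose A \<and> (\<forall>j. S $ j $ j = 0 \<longrightarrow> column j A = 0)"
  using assms
proof (induction "card {j. S $ j $ j \<noteq> 0}" arbitrary: S rule: less_induct)
  case less
  have sym: "S $ r $ s = S $ s $ r" for r s
    using arg_cong[OF less.prems(1), of "\<lambda>A. A $ s $ r"] by (simp add: transpose_def)
  have entry: "axis r 1 \<bullet> (S *v axis s 1) = S $ r $ s" for r s
    by (simp add: inner_axis' matrix_vector_mul_component inner_axis)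
  have sym': "x \<bullet> (S *v y) = y \<bullet> (S *v x)" for x y
    using dot_lmul_matrix[of x S y] transpose_matrix_vector[of S x] less.prems(1) by (simp add: inner_commute)
  have quad: "0 \<le> x \<bullet> (S *v x) - 2 * c * (y \<bullet> (S *v x)) + c\<^sup>2 * (y \<bullet> (S *v y))" for x y c
    using less.prems(2)[of "x - c *\<^sub>R y"] sym'[of x y]
    by (simp add: matrix_vector_mult_diff_distrib matrix_vector_mult_scaleR inner_diff_left inner_diff_right
        power2_eq_square algebra_simps)
  show ?case
  proof (cases "\<exists>i. S $ i $ i \<noteq> 0")
    case False
    \<comment> \<open>With a zero diagonal the quadratic form at a difference and at a sum of two
      unit vectors is minus and plus twice the off-diagonal entry; both are nonnegative.\<close>
    have "S $ r $ s = 0" for r s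
      using quad[of "axis r 1" 1 "axis s 1"] quad[of "axis r 1" "-1" "axis s 1"] False sym[of r s]
      by (simp add: entry)
    then have "S = 0" by (simp add: vec_eq_iff)
    then show ?thesis
      by (intro exI[of _ 0]) (simp add: vec_eq_iff matrix_matrix_mult_def column_def)
  next
    case True
    then obtain i where i: "S $ i $ i \<noteq> 0" by blast
    have pos: "0 < S $ i $ i"
      using less.prems(2)[of "axis i 1"] i by (simp add: entry)
    define S' :: "real ^ 'n ^ 'n" where "S' = (\<chi> r s. S $ r $ s - S $ r $ i * S $ s $ i / S $ i $ i)"
    have S'_diag: "S' $ j $ j = S $ j $ j - (S $ j $ i)\<^sup>2 / S $ i $ i" for j
      by (simp add: S'_def power2_eq_square)
    have S'v: "t \<bullet> (S' *v t) = t \<bullet> (S *v t) - (axis i 1 \<bullet> (S *v t))\<^sup>2 / S $ i $ i" for t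
    proof -
      have "axis i 1 \<bullet> (S *v t) = (\<Sum>s\<in>UNIV. S $ s $ i * t $ s)"
        by (simp add: inner_axis' matrix_vector_mult_def sym[of i])
      moreover have "S' *v t = S *v t - ((\<Sum>s\<in>UNIV. S $ s $ i * t $ s) / S $ i $ i) *\<^sub>R (\<chi> r. S $ r $ i)"
        by (simp add: S'_def vec_eq_iff matrix_vector_mult_def left_diff_distrib right_diff_distrib sum_subtractf
            sum_divide_distrib sum_distrib_left sum_distrib_right mult_ac)
      moreover have "t \<bullet> (\<chi> r. S $ r $ i) = (\<Sum>s\<in>UNIV. S $ s $ i * t $ s)"
        by (simp add: inner_vec_def mult.commute)
      ultimately show ?thesis
        by (simp add: inner_diff_right power2_eq_square)
    qed
    have "transpose S' = S'"
      by (simp add: S'_def transpose_def vec_eq_iff sym mult.commute)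
    \<comment> \<open>The chosen coefficient minimises \<open>quad\<close> over \<open>c\<close>,
      and the minimum is the quadratic form of \<open>S'\<close>.\<close>
    moreover have psd: "0 \<le> t \<bullet> (S' *v t)" for t
      using quad[of t "(axis i 1 \<bullet> (S *v t)) / S $ i $ i" "axis i 1"] pos
      by (simp add: S'v entry power2_eq_square field_simps)
    \<comment> \<open>On the diagonal only a nonnegative quantity is subtracted, so zeros persist.
      This makes the number of nonzero diagonal entries drop strictly and passes the column
      condition on from \<open>A'\<close> to \<open>A\<close>.\<close>
    moreover have zero: "S' $ j $ j = 0" if "S $ j $ j = 0" for j
    proof -
      have "0 \<le> S' $ j $ j"
        using psd[of "axis j 1"] by (simp add: inner_axis' matrix_vector_mul_component inner_axis)
      moreover have "S' $ j $ j \<le> 0"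
        unfolding S'_diag using that pos by simp
      ultimately show ?thesis by simp
    qed
    have "S' $ i $ i = 0"
      using pos by (simp add: S'_diag power2_eq_square)
    with zero i have "{j. S' $ j $ j \<noteq> 0} \<subset> {j. S $ j $ j \<noteq> 0}" by auto
    then have "card {j. S' $ j $ j \<noteq> 0} < card {j. S $ j $ j \<noteq> 0}"
      by (intro psubset_card_mono) auto
    ultimately obtain A' where A': "S' = A' ** transpose A'" "\<And>j. S' $ j $ j = 0 \<Longrightarrow> column j A' = 0"
      using less.hyps by blast
    have A'_i: "A' $ r $ i = 0" for r
      using A'(2)[OF \<open>S' $ i $ i = 0\<close>] by (simp add: column_def vec_eq_iff)
    define A :: "real ^ 'n ^ 'n"
      where "A = (\<chi> r j. if j = i then S $ r $ i / sqrt (S $ i $ i) else A' $ r $ j)"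
    have "(A ** transpose A) $ r $ s = S $ r $ s" for r s
    proof -
      have "(A ** transpose A) $ r $ s = (\<Sum>j\<in>UNIV. A $ r $ j * A $ s $ j)"
        by (simp add: matrix_matrix_mult_def transpose_def)
      also have "\<dots> = (\<Sum>j\<in>UNIV. A' $ r $ j * A' $ s $ j +
          (if j = i then S $ r $ i / sqrt (S $ i $ i) * (S $ s $ i / sqrt (S $ i $ i)) else 0))"
        by (intro sum.cong) (auto simp: A_def A'_i)
      also have "\<dots> = S' $ r $ s + S $ r $ i / sqrt (S $ i $ i) * (S $ s $ i / sqrt (S $ i $ i))"
        by (simp add: sum.distrib A'(1) matrix_matrix_mult_def transpose_def)
      also have "\<dots> = S $ r $ s"
        using pos by (simp add: S'_def)
      finally show ?thesis .
    qed
    then have "S = A ** transpose A" by (simp add: vec_eq_iff)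
    moreover have "column j A = 0" if "S $ j $ j = 0" for j
      using that i A'(2)[OF zero[OF that]] by (auto simp: column_def vec_eq_iff A_def)
    ultimately show ?thesis by blast
  qed
qed

lemma psd_factorization:
  fixes S :: "real ^ 'n ^ 'n"
  assumes "transpose S = S" and "\<And>t. 0 \<le> t \<bullet> (S *v t)"
  obtains A :: "real ^ 'n ^ 'n" where "S = A ** transpose A"
  using psd_factorization_aux[OF assms] by blast

section \<open>Normal laws through their characteristic functions\<close>

lemma norm_iexp_diff_le: "norm (iexp a - iexp b) \<le> \<bar>a - b\<bar>"
proof -
  have "iexp a - iexp b = iexp b * (iexp (a - b) - 1)"
    by (simp add: algebra_simps flip: exp_add)
  then have "norm (iexp a - iexp b) = norm (iexp (a - b) - 1)"
    by (simp add: norm_mult)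
  also have "\<dots> \<le> \<bar>a - b\<bar>"
    using iexp_approx1[of "a - b" 0] by simp
  finally show ?thesis .
qed

text \<open>Scaling a standard normal variable by \<open>sqrt v\<close> covers the point mass and
  the density at once, so later computations need no case distinction.\<close>

lemma normal_law_eq_distr:
  assumes "0 \<le> v"
  shows "normal_law 0 v = distr std_normal_distribution borel (\<lambda>x. sqrt v * x)"
proof (cases "v = 0")
  case True
  interpret real_distribution std_normal_distribution by (rule real_dist_normal_dist)
  show ?thesis using True by (simp add: normal_law_def)
next
  case False
  with assms have v: "0 < v" by simp
  interpret real_distribution std_normal_distribution by (rule real_dist_normal_dist)
  have "distributed std_normal_distribution lborel (\<lambda>x. x) std_normal_density"
    by (auto simp: distributed_def distr_id2)
  then have "distributed std_normal_distribution lborel (\<lambda>x. 0 + x * sqrt v) (normal_density 0 (sqrt v))"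
    using normal_standard_normal_convert[of "sqrt v" "\<lambda>x. 0 + x * sqrt v" 0] v by simp
  then show ?thesis
    using v by (simp add: distributed_def normal_law_def mult.commute cong: distr_cong)
qed

lemma real_distribution_normal_law: "0 \<le> v \<Longrightarrow> real_distribution (normal_law 0 v)"
  unfolding normal_law_eq_distr
  by (intro prob_space.real_distribution_distr prob_space_normal_density) auto

lemma char_normal_law:
  assumes "0 \<le> v"
  shows "char (normal_law 0 v) s = exp (- (v * s\<^sup>2) / 2)"
proof -
  have "char (normal_law 0 v) s = char std_normal_distribution (sqrt v * s)"
    unfolding char_def normal_law_eq_distr[OF assms]
    by (subst integral_distr) (auto simp: mult_ac)
  then show ?thesis
    using assms by (simp add: char_std_normal_distribution power_mult_distrib)
qed

text \<open>The image of the standard Gaussian under a factor \<open>A\<close> of \<open>S\<close>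
  works: its characteristic function at \<open>t\<close> is the standard one at
  \<open>transpose A *v t\<close>, whose squared norm is \<open>t \<bullet> (S *v t)\<close>.
  Uniqueness on the line then identifies every linear functional.\<close>

lemma normal_exists:
  fixes S :: "real ^ 'k ^ 'k"
  assumes sym: "transpose S = S" and psd: "\<And>t. 0 \<le> t \<bullet> (S *v t)"
  obtains N where "is_normal N 0 S" "prob_space N" "sets N = sets borel"
    "\<And>t. (CLINT x|N. iexp (t \<bullet> x)) = exp (- (t \<bullet> (S *v t)) / 2)"
proof -
  obtain A :: "real ^ 'k ^ 'k" where A: "S = A ** transpose A"
    using psd_factorization[OF sym psd] .
  interpret \<gamma>: prob_space "std_gaussian :: (real ^ 'k) measure" by (rule prob_space_std_gaussian)
  have meas [measurable]: "(\<lambda>x. A *v x) \<in> borel_measurable borel"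
    by (intro borel_measurable_continuous_onI linear_continuous_on matrix_vector_mul_bounded_linear)
  define N where "N = distr std_gaussian borel (\<lambda>x. A *v x)"
  interpret N: prob_space N unfolding N_def by (intro \<gamma>.prob_space_distr) simp
  have sets [simp, measurable_cong]: "sets N = sets borel" by (simp add: N_def)
  have inner: "t \<bullet> (A *v x) = (transpose A *v t) \<bullet> x" for t x
    using dot_lmul_matrix[of t A x] by simp
  have var: "(norm (transpose A *v t))\<^sup>2 = t \<bullet> (S *v t)" for t
    using inner[of t "transpose A *v t"] by (simp add: A power2_norm_eq_inner flip: matrix_vector_mul_assoc)
  have char: "(CLINT x|N. iexp (t \<bullet> x)) = exp (- (t \<bullet> (S *v t)) / 2)" for t
  proof -
    have "(CLINT x|N. iexp (t \<bullet> x)) = (CLINT x|std_gaussian. iexp (t \<bullet> (A *v x)))"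
      unfolding N_def by (rule integral_distr) measurable
    then show ?thesis
      by (simp only: inner char_std_gaussian var)
  qed
  have "distr N borel (\<lambda>x. t \<bullet> x) = normal_law (t \<bullet> 0) (t \<bullet> (S *v t))" for t
  proof (rule Levy_uniqueness)
    show "real_distribution (distr N borel (\<lambda>x. t \<bullet> x))"
      by (intro N.real_distribution_distr) measurable
    show "real_distribution (normal_law (t \<bullet> 0) (t \<bullet> (S *v t)))"
      using psd by (simp add: real_distribution_normal_law)
    show "char (distr N borel (\<lambda>x. t \<bullet> x)) = char (normal_law (t \<bullet> 0) (t \<bullet> (S *v t)))"
    proof
      fix s
      have "char (distr N borel (\<lambda>x. t \<bullet> x)) s = (CLINT x|N. iexp ((s *\<^sub>R t) \<bullet> x))"
        unfolding char_def by (subst integral_distr) auto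
      also have "\<dots> = char (normal_law (t \<bullet> 0) (t \<bullet> (S *v t))) s"
        unfolding char using psd[of t]
        by (simp add: char_normal_law matrix_vector_mult_scaleR power2_eq_square mult_ac)
      finally show "char (distr N borel (\<lambda>x. t \<bullet> x)) s = char (normal_law (t \<bullet> 0) (t \<bullet> (S *v t))) s" .
    qed
  qed
  with sym psd have "is_normal N 0 S" by (simp add: is_normal_def)
  then show ?thesis using that N.prob_space_axioms sets char by blast
qed

section \<open>The central limit theorem and the delta method\<close>

text \<open>Used with \<open>Suc\<close>, as the sample starts at index 1 while
  \<open>central_limit_theorem_zero_mean\<close> sums over \<open>k < n\<close>. Injectivity lets a
  choice of events over \<open>J\<close> be read as one over the image of \<open>J\<close>.\<close>

lemma (in prob_space) indep_vars_reindex: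
  assumes "indep_vars M' X (f ` I)" and f: "inj_on f I"
  shows "indep_vars (\<lambda>i. M' (f i)) (\<lambda>i. X (f i)) I"
proof -
  have "indep_sets (\<lambda>i. F (f i)) I" if "indep_sets F (f ` I)" for F
    unfolding indep_sets_def
  proof (intro conjI ballI allI impI)
    show "F (f i) \<subseteq> events" if "i \<in> I" for i
      using \<open>indep_sets F (f ` I)\<close> that by (auto simp: indep_sets_def)
    fix J A assume J: "J \<subseteq> I" "J \<noteq> {}" "finite J" and A: "A \<in> (\<Pi> j\<in>J. F (f j))"
    have inj: "inj_on f J" using f J(1) by (rule inj_on_subset)
    define A' where "A' = A \<circ> the_inv_into J f"
    have A': "A' (f j) = A j" if "j \<in> J" for j
      using inj that by (simp add: A'_def the_inv_into_f_f)
    have "A' \<in> Pi (f ` J) F" using A by (auto simp: A')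
    then have "prob (\<Inter>j\<in>f ` J. A' j) = (\<Prod>j\<in>f ` J. prob (A' j))"
      using J by (intro indep_setsD[OF that]) auto
    then show "prob (\<Inter>j\<in>J. A j) = (\<Prod>j\<in>J. prob (A j))"
      using inj by (simp add: A' prod.reindex)
  qed
  then show ?thesis
    using assms(1) by (auto simp: indep_vars_def2)
qed

text \<open>In terms of characteristic functions the degenerate case fits in: for
  \<open>v = 0\<close> the variables vanish almost surely and the limit is 1. Otherwise the central
  limit theorem for standardised sums applies.\<close>

lemma (in prob_space) clt_char:
  fixes Z :: "nat \<Rightarrow> 'a \<Rightarrow> real"
  assumes indep: "indep_vars (\<lambda>_. borel) Z UNIV"
    and mean: "\<And>n. expectation (Z n) = 0"
    and sq: "\<And>n. integrable M (\<lambda>\<omega>. (Z n \<omega>)\<^sup>2)"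
    and var: "\<And>n. expectation (\<lambda>\<omega>. (Z n \<omega>)\<^sup>2) = v"
    and distr: "\<And>n. distr M borel (Z n) = \<mu>"
  shows "(\<lambda>n. CLINT \<omega>|M. iexp ((\<Sum>k=1..n. Z k \<omega>) / sqrt (real n))) \<longlonglongrightarrow> exp (- v / 2)"
proof -
  have [measurable]: "Z n \<in> borel_measurable M" for n
    using indep by (auto simp: indep_vars_def2)
  have "0 \<le> v" unfolding var[of 0, symmetric] by simp
  have shift: "(\<Sum>k=1..n. Z k \<omega>) = (\<Sum>k<n. Z (Suc k) \<omega>)" for n \<omega>
    by (simp add: sum.atLeast1_atMost_eq)
  show ?thesis
  proof (cases "v = 0")
    case True
    have "AE \<omega> in M. \<forall>n. Z n \<omega> = 0"
      using integral_nonneg_eq_0_iff_AE[OF sq] var True by (subst AE_all_countable) auto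
    then have "(CLINT \<omega>|M. iexp ((\<Sum>k=1..n. Z k \<omega>) / sqrt (real n))) = (CLINT \<omega>|M. 1)" for n
      by (intro integral_cong_AE) (auto elim!: eventually_mono)
    then show ?thesis using True by (simp add: prob_space)
  next
    case False
    with \<open>0 \<le> v\<close> have v: "0 < v" by simp
    have "weak_conv_m (\<lambda>n. distr M borel (\<lambda>\<omega>. (\<Sum>k<n. Z (Suc k) \<omega>) / sqrt (real n * (sqrt v)\<^sup>2)))
        std_normal_distribution"
    proof (rule central_limit_theorem_zero_mean)
      show "indep_vars (\<lambda>_. borel) (\<lambda>k. Z (Suc k)) UNIV"
        using indep_vars_reindex[of "\<lambda>_. borel" Z Suc UNIV] indep_vars_subset[OF indep, of "range Suc"]
        by simp
    qed (use v in \<open>auto simp: mean sq var distr\<close>)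
    \<comment> \<open>Evaluating at \<open>sqrt v\<close> undoes the standardisation, leaving the
      factor \<open>1 / sqrt n\<close>.\<close>
    from levy_continuity1[OF _ _ this, of "sqrt v"]
    have "(\<lambda>n. char (distr M borel (\<lambda>\<omega>. (\<Sum>k<n. Z (Suc k) \<omega>) / sqrt (real n * (sqrt v)\<^sup>2))) (sqrt v))
        \<longlonglongrightarrow> char std_normal_distribution (sqrt v)"
      by (simp add: real_distribution_distr real_dist_normal_dist)
    moreover have "char (distr M borel (\<lambda>\<omega>. (\<Sum>k<n. Z (Suc k) \<omega>) / sqrt (real n * (sqrt v)\<^sup>2))) (sqrt v) =
        (CLINT \<omega>|M. iexp ((\<Sum>k=1..n. Z k \<omega>) / sqrt (real n)))" for n
      unfolding char_def shift
      by (subst integral_distr) (use v in \<open>auto simp: real_sqrt_mult\<close>)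
    ultimately show ?thesis
      using v by (simp add: char_std_normal_distribution)
  qed
qed

section \<open>Second moments of sample means and the linearisation error\<close>

text \<open>By induction: the cross term with the new summand factorises by independence and
  vanishes by centring. Boundedness supplies the integrability.\<close>

lemma (in prob_space) expectation_sum_sq:
  fixes Z :: "'i \<Rightarrow> 'a \<Rightarrow> real"
  assumes "finite I" and "indep_vars (\<lambda>_. borel) Z I"
    and "\<And>i. i \<in> I \<Longrightarrow> expectation (Z i) = 0"
    and "\<And>i \<omega>. i \<in> I \<Longrightarrow> \<bar>Z i \<omega>\<bar> \<le> B"
  shows "expectation (\<lambda>\<omega>. (\<Sum>i\<in>I. Z i \<omega>)\<^sup>2) = (\<Sum>i\<in>I. expectation (\<lambda>\<omega>. (Z i \<omega>)\<^sup>2))"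
  using assms
proof (induction I)
  case (insert i I)
  have [measurable]: "Z j \<in> borel_measurable M" if "j \<in> insert i I" for j
    using insert.prems(1) that by (auto simp: indep_vars_def2)
  have bound: "\<bar>\<Sum>j\<in>I. Z j \<omega>\<bar> \<le> card I * B" for \<omega>
    using insert.prems(3) by (intro order_trans[OF sum_abs] sum_bounded_above) auto
  have sq: "\<bar>x * y\<bar> \<le> a * b" if "\<bar>x\<bar> \<le> a" "\<bar>y\<bar> \<le> b" for x y a b :: real
    unfolding abs_mult using that by (intro mult_mono) auto
  have Zi: "integrable M (Z i)"
    using insert.prems(3) by (intro integrable_const_bound[where B=B]) auto
  have S: "integrable M (\<lambda>\<omega>. \<Sum>j\<in>I. Z j \<omega>)"
    using bound by (intro integrable_const_bound[where B="card I * B"]) auto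
  have Zi2: "integrable M (\<lambda>\<omega>. Z i \<omega> * Z i \<omega>)"
  proof (rule integrable_const_bound)
    show "AE \<omega> in M. norm (Z i \<omega> * Z i \<omega>) \<le> B * B"
      unfolding real_norm_def by (intro AE_I2 sq insert.prems(3)) simp_all
  qed measurable
  have S2: "integrable M (\<lambda>\<omega>. (\<Sum>j\<in>I. Z j \<omega>) * (\<Sum>j\<in>I. Z j \<omega>))"
  proof (rule integrable_const_bound)
    show "AE \<omega> in M. norm ((\<Sum>j\<in>I. Z j \<omega>) * (\<Sum>j\<in>I. Z j \<omega>)) \<le> (card I * B) * (card I * B)"
      unfolding real_norm_def by (intro AE_I2 sq bound)
  qed measurable
  have indep: "indep_var borel (Z i) borel (\<lambda>\<omega>. \<Sum>j\<in>I. Z j \<omega>)"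
    using insert by (intro indep_vars_sum) auto
  have cross: "integrable M (\<lambda>\<omega>. Z i \<omega> * (\<Sum>j\<in>I. Z j \<omega>))"
    "expectation (\<lambda>\<omega>. Z i \<omega> * (\<Sum>j\<in>I. Z j \<omega>)) = 0"
    using indep_var_integrable[OF indep Zi S] indep_var_lebesgue_integral[OF indep Zi S] insert.prems(2)
    by auto
  have IH: "expectation (\<lambda>\<omega>. (\<Sum>j\<in>I. Z j \<omega>)\<^sup>2) = (\<Sum>j\<in>I. expectation (\<lambda>\<omega>. (Z j \<omega>)\<^sup>2))"
    using insert.prems by (intro insert.IH indep_vars_subset[OF insert.prems(1)]) auto
  have "expectation (\<lambda>\<omega>. (\<Sum>j\<in>insert i I. Z j \<omega>)\<^sup>2) = expectation (\<lambda>\<omega>.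
      Z i \<omega> * Z i \<omega> + 2 * (Z i \<omega> * (\<Sum>j\<in>I. Z j \<omega>)) + (\<Sum>j\<in>I. Z j \<omega>) * (\<Sum>j\<in>I. Z j \<omega>))"
    using insert.hyps by (simp add: power2_eq_square algebra_simps)
  also have "\<dots> = expectation (\<lambda>\<omega>. Z i \<omega> * Z i \<omega>) + expectation (\<lambda>\<omega>. (\<Sum>j\<in>I. Z j \<omega>) * (\<Sum>j\<in>I. Z j \<omega>))"
    using Zi2 S2 cross by simp
  finally show ?case
    using insert.hyps IH by (simp add: power2_eq_square)
qed simp

lemma (in prob_space) expectation_mean_sq_le:
  fixes Z :: "nat \<Rightarrow> 'a \<Rightarrow> real"
  assumes indep: "indep_vars (\<lambda>_. borel) Z UNIV"
    and mean: "\<And>n. expectation (Z n) = 0" and B: "\<And>n \<omega>. \<bar>Z n \<omega>\<bar> \<le> B"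
  shows "expectation (\<lambda>\<omega>. (1 / real n * (\<Sum>k=1..n. Z k \<omega>))\<^sup>2) \<le> B\<^sup>2 / real n"
proof -
  have [measurable]: "Z n \<in> borel_measurable M" for n
    using indep by (auto simp: indep_vars_def2)
  have sq: "(Z k \<omega>)\<^sup>2 \<le> B\<^sup>2" for k \<omega>
    using power_mono[OF B[of k \<omega>], of 2] by simp
  have "expectation (\<lambda>\<omega>. (1 / real n * (\<Sum>k=1..n. Z k \<omega>))\<^sup>2) =
      1 / (real n)\<^sup>2 * (\<Sum>k=1..n. expectation (\<lambda>\<omega>. (Z k \<omega>)\<^sup>2))"
    using expectation_sum_sq[OF _ indep_vars_subset[OF indep] mean B, of "{1..n}"]
    by (simp add: power_mult_distrib power_divide)
  also have "\<dots> \<le> 1 / (real n)\<^sup>2 * (\<Sum>k=1..n. B\<^sup>2)"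
  proof (intro mult_left_mono sum_mono)
    fix k
    have "integrable M (\<lambda>\<omega>. (Z k \<omega>)\<^sup>2)"
      using sq by (intro integrable_const_bound[where B="B\<^sup>2"]) auto
    then have "expectation (\<lambda>\<omega>. (Z k \<omega>)\<^sup>2) \<le> expectation (\<lambda>\<omega>. B\<^sup>2)"
      using sq by (intro integral_mono) auto
    then show "expectation (\<lambda>\<omega>. (Z k \<omega>)\<^sup>2) \<le> B\<^sup>2" by (simp add: prob_space)
  qed simp
  also have "\<dots> = B\<^sup>2 / real n"
    by (simp add: power2_eq_square)
  finally show ?thesis .
qed

definition sample_mean :: "(nat \<Rightarrow> 'a \<Rightarrow> 'b::real_normed_vector) \<Rightarrow> nat \<Rightarrow> 'a \<Rightarrow> 'b"
  where "sample_mean V n \<omega> = (1 / real n) *\<^sub>R (\<Sum>k=1..n. V k \<omega>)"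

lemma norm_sample_mean_le:
  assumes "\<And>k. norm (V k \<omega>) \<le> B"
  shows "norm (sample_mean V n \<omega>) \<le> B"
proof (cases "n = 0")
  case True
  \<comment> \<open>Division by zero makes the empty mean 0, so only the sign of \<open>B\<close>
    matters.\<close>
  have "0 \<le> B" using assms[of 0] norm_ge_zero order_trans by blast
  then show ?thesis using True by (simp add: sample_mean_def)
next
  case False
  have "norm (\<Sum>k=1..n. V k \<omega>) \<le> real n * B"
    using sum_norm_bound[of "{1..n}" "\<lambda>k. V k \<omega>" B] assms by simp
  then show ?thesis
    using False by (simp add: sample_mean_def field_simps)
qed

text \<open>Close to \<open>m\<close> differentiability gives the linear term; at distance at least
  \<open>d\<close> compactness bounds the remainder by \<open>K\<close>, which is absorbed into
  \<open>K / d\<^sup>2\<close> times the squared distance. After scaling by \<open>sqrt n\<close>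
  the first term stays proportional to \<open>e\<close> and the second tends to 0 in mean.\<close>

lemma has_derivative_remainder_le:
  fixes h :: "'b::euclidean_space \<Rightarrow> 'c::euclidean_space"
  assumes cont: "continuous_on UNIV h" and deriv: "(h has_derivative h') (at m)" and "0 < e"
  obtains C where "0 \<le> C"
    "\<And>x. norm x \<le> B \<Longrightarrow> norm (h x - h m - h' (x - m)) \<le> e * norm (x - m) + C * (norm (x - m))\<^sup>2"
proof -
  interpret bounded_linear h' using deriv by (rule has_derivative_bounded_linear)
  obtain d where "0 < d"
    and d: "\<And>x. norm (x - m) < d \<Longrightarrow> norm (h x - h m - h' (x - m)) \<le> e * norm (x - m)"
    using deriv \<open>0 < e\<close> unfolding has_derivative_at_alt by blast
  have "continuous_on (cball 0 B) (\<lambda>x. h x - h m - h' (x - m))"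
    by (intro continuous_intros continuous_on_subset[OF cont] continuous_on) auto
  then have "bounded ((\<lambda>x. h x - h m - h' (x - m)) ` cball 0 B)"
    by (intro compact_imp_bounded compact_continuous_image compact_cball)
  then obtain K where "0 < K" and K: "\<And>x. norm x \<le> B \<Longrightarrow> norm (h x - h m - h' (x - m)) \<le> K"
    unfolding bounded_pos by auto
  show ?thesis
  proof (rule that[of "K / d\<^sup>2"])
    fix x :: 'b assume x: "norm x \<le> B"
    show "norm (h x - h m - h' (x - m)) \<le> e * norm (x - m) + K / d\<^sup>2 * (norm (x - m))\<^sup>2"
    proof (cases "norm (x - m) < d")
      case True
      have "0 \<le> K / d\<^sup>2 * (norm (x - m))\<^sup>2" using \<open>0 < K\<close> by simp
      then show ?thesis using d[OF True] by linarith
    next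
      case False
      then have "d\<^sup>2 \<le> (norm (x - m))\<^sup>2" using \<open>0 < d\<close> by (intro power_mono) auto
      then have "K \<le> K / d\<^sup>2 * (norm (x - m))\<^sup>2"
        using \<open>0 < K\<close> \<open>0 < d\<close> by (simp add: field_simps)
      moreover have "0 \<le> e * norm (x - m)" using \<open>0 < e\<close> by simp
      ultimately show ?thesis using K[OF x] by linarith
    qed
  qed (use \<open>0 < K\<close> in simp)
qed

lemma (in prob_space) norm_char_diff_le:
  assumes [measurable]: "X \<in> borel_measurable M" "Y \<in> borel_measurable M"
    and w: "integrable M w" and le: "\<And>\<omega>. \<bar>X \<omega> - Y \<omega>\<bar> \<le> w \<omega>"
  shows "norm ((CLINT \<omega>|M. iexp (X \<omega>)) - (CLINT \<omega>|M. iexp (Y \<omega>))) \<le> expectation w"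
proof -
  have int: "integrable M (\<lambda>\<omega>. iexp (X \<omega>))" "integrable M (\<lambda>\<omega>. iexp (Y \<omega>))"
    by (rule integrable_const_bound[where B=1]; simp)+
  have "norm (CLINT \<omega>|M. iexp (X \<omega>) - iexp (Y \<omega>)) \<le> expectation (\<lambda>\<omega>. norm (iexp (X \<omega>) - iexp (Y \<omega>)))"
    by (rule integral_norm_bound)
  also have "\<dots> \<le> expectation w"
    by (rule integral_mono[OF _ w order_trans[OF norm_iexp_diff_le le]])
      (intro integrable_norm Bochner_Integration.integrable_diff int)
  finally show ?thesis
    using int by (simp only: Bochner_Integration.integral_diff)
qed

section \<open>Sample means of bounded i.i.d. vectors\<close>

text \<open>Interpreted twice in the final proof: for the vector of powers and for the vector of
  products of two powers.\<close>

locale bounded_iid = prob_space M for M :: "'a measure" +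
  fixes V :: "nat \<Rightarrow> 'a \<Rightarrow> real ^ 'q" and B :: real and \<mu> :: "(real ^ 'q) measure"
    and m :: "real ^ 'q"
  assumes indep: "indep_vars (\<lambda>_. borel) V UNIV"
    and distr: "\<And>n. distr M borel (V n) = \<mu>"
    and bound: "\<And>n \<omega>. norm (V n \<omega>) \<le> B"
    and mean: "m = (\<chi> i. expectation (\<lambda>\<omega>. V 0 \<omega> $ i))"
begin

lemma V_measurable [measurable]: "V n \<in> borel_measurable M"
  using indep by (auto simp: indep_vars_def2)

lemma sample_mean_measurable [measurable]: "sample_mean V n \<in> borel_measurable M"
  unfolding sample_mean_def by measurable

lemma component_measurable [measurable]: "(\<lambda>\<omega>. f \<omega> $ i) \<in> borel_measurable M"
  if [measurable]: "f \<in> borel_measurable M" for f :: "'a \<Rightarrow> real ^ 'n"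
  by (rule measurable_compose[OF that])
    (intro borel_measurable_continuous_onI continuous_intros)

lemma component_le: "\<bar>V n \<omega> $ i\<bar> \<le> B"
  using component_le_norm_cart[of "V n \<omega>" i] bound[of n \<omega>] by linarith

lemma component_integrable [simp]: "integrable M (\<lambda>\<omega>. V n \<omega> $ i)"
  by (rule integrable_const_bound[where B=B]) (auto simp: component_le)

lemma expectation_compose:
  assumes [measurable]: "g \<in> borel_measurable borel"
  shows "expectation (\<lambda>\<omega>. g (V n \<omega>)) = expectation (\<lambda>\<omega>. g (V 0 \<omega>) :: real)"
  using integral_distr[of "V n" M borel g] integral_distr[of "V 0" M borel g] by (simp add: distr)

lemma expectation_component: "expectation (\<lambda>\<omega>. V n \<omega> $ i) = m $ i"
  using expectation_compose[of "\<lambda>x. x $ i" n]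
  by (simp add: mean borel_measurable_continuous_onI continuous_intros)

lemma mean_component_le: "\<bar>m $ i\<bar> \<le> B"
proof -
  have "\<bar>expectation (\<lambda>\<omega>. V 0 \<omega> $ i)\<bar> \<le> expectation (\<lambda>\<omega>. \<bar>V 0 \<omega> $ i\<bar>)"
    by (rule integral_abs_bound)
  also have "\<dots> \<le> expectation (\<lambda>_. B)"
    by (intro integral_mono) (auto simp: component_le)
  finally show ?thesis by (simp add: expectation_component prob_space)
qed

lemma sample_mean_sq_integrable: "integrable M (\<lambda>\<omega>. (norm (sample_mean V n \<omega> - m))\<^sup>2)"
proof (rule integrable_const_bound)
  have "norm (sample_mean V n \<omega> - m) \<le> B + norm m" for \<omega>
    using norm_triangle_ineq4[of "sample_mean V n \<omega>" m] norm_sample_mean_le[of V \<omega> B n] bound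
    by fastforce
  then show "AE \<omega> in M. norm ((norm (sample_mean V n \<omega> - m))\<^sup>2) \<le> (B + norm m)\<^sup>2"
    by (auto intro!: power_mono)
qed measurable

text \<open>The squared norm is a sum over coordinates, each a squared mean of independent centred
  variables bounded by \<open>2 * B\<close>.\<close>

lemma expectation_sample_mean_sq_le:
  assumes "0 < n"
  shows "expectation (\<lambda>\<omega>. (norm (sample_mean V n \<omega> - m))\<^sup>2) \<le> CARD('q) * (2 * B)\<^sup>2 / real n"
proof -
  have comp: "(sample_mean V n \<omega> - m) $ i = 1 / real n * (\<Sum>k=1..n. V k \<omega> $ i - m $ i)" for i \<omega>
  proof -
    have "(\<Sum>k=1..n. V k \<omega> $ i - m $ i) = (\<Sum>k=1..n. V k \<omega>) $ i - real n * m $ i"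
      by (simp add: sum_subtractf)
    then show ?thesis
      using assms by (simp add: sample_mean_def right_diff_distrib)
  qed
  have le: "\<bar>V k \<omega> $ i - m $ i\<bar> \<le> 2 * B" for k \<omega> i
    using component_le[of k \<omega> i] mean_component_le[of i] by linarith
  have mean_le: "\<bar>1 / real n * (\<Sum>k=1..n. V k \<omega> $ i - m $ i)\<bar> \<le> 2 * B" for i \<omega>
    using norm_sample_mean_le[of "\<lambda>k \<omega>. V k \<omega> $ i - m $ i" \<omega> "2 * B" n, unfolded real_norm_def, OF le]
    by (simp add: sample_mean_def)
  have "(1 / real n * (\<Sum>k=1..n. V k \<omega> $ i - m $ i))\<^sup>2 \<le> (2 * B)\<^sup>2" for i \<omega>
    using power_mono[OF mean_le[of \<omega> i] abs_ge_zero, of 2] unfolding power2_abs .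
  then have int: "integrable M (\<lambda>\<omega>. (1 / real n * (\<Sum>k=1..n. V k \<omega> $ i - m $ i))\<^sup>2)" for i
    by (intro integrable_const_bound[where B="(2 * B)\<^sup>2"]) auto
  have "expectation (\<lambda>\<omega>. (norm (sample_mean V n \<omega> - m))\<^sup>2) =
      expectation (\<lambda>\<omega>. \<Sum>i\<in>UNIV. (1 / real n * (\<Sum>k=1..n. V k \<omega> $ i - m $ i))\<^sup>2)"
    unfolding comp[symmetric] power2_norm_eq_inner inner_vec_def by (simp add: power2_eq_square)
  also have "\<dots> = (\<Sum>i\<in>UNIV. expectation (\<lambda>\<omega>. (1 / real n * (\<Sum>k=1..n. V k \<omega> $ i - m $ i))\<^sup>2))"
    by (rule Bochner_Integration.integral_sum) (rule int)
  also have "\<dots> \<le> (\<Sum>i\<in>(UNIV :: 'q set). (2 * B)\<^sup>2 / real n)"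
  proof (rule sum_mono)
    fix i :: 'q
    have "indep_vars (\<lambda>_. borel) (\<lambda>k \<omega>. V k \<omega> $ i - m $ i) UNIV"
      by (rule indep_vars_compose2[OF indep])
        (intro borel_measurable_continuous_onI continuous_intros)
    then show "expectation (\<lambda>\<omega>. (1 / real n * (\<Sum>k=1..n. V k \<omega> $ i - m $ i))\<^sup>2) \<le> (2 * B)\<^sup>2 / real n"
      by (rule expectation_mean_sq_le) (auto simp: le expectation_component prob_space)
  qed
  finally show ?thesis by simp
qed

text \<open>Chebyshev: Markov's inequality for the squared error, whose expectation is of order
  \<open>1 / n\<close>.\<close>

lemma sample_mean_converges_in_prob: "converges_in_prob M (sample_mean V) m"
  unfolding converges_in_prob_def
proof (intro allI impI)
  fix e :: real assume "0 < e"
  have "(\<lambda>n. CARD('q) * (2 * B)\<^sup>2 / real n / e\<^sup>2) \<longlonglongrightarrow> 0 / e\<^sup>2"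
    using \<open>0 < e\<close> by (intro tendsto_divide tendsto_const lim_const_over_n) auto
  then have lim: "(\<lambda>n. CARD('q) * (2 * B)\<^sup>2 / real n / e\<^sup>2) \<longlonglongrightarrow> 0" by simp
  have "prob {\<omega> \<in> space M. e < dist (sample_mean V n \<omega>) m} \<le> CARD('q) * (2 * B)\<^sup>2 / real n / e\<^sup>2"
    if "0 < n" for n
  proof -
    have "prob {\<omega> \<in> space M. e < dist (sample_mean V n \<omega>) m} \<le>
        prob {\<omega> \<in> space M. e\<^sup>2 \<le> (norm (sample_mean V n \<omega> - m))\<^sup>2}"
    proof (rule finite_measure_mono)
      show "{\<omega> \<in> space M. e < dist (sample_mean V n \<omega>) m} \<subseteq>
          {\<omega> \<in> space M. e\<^sup>2 \<le> (norm (sample_mean V n \<omega> - m))\<^sup>2}"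
        unfolding dist_norm using power_mono[of e _ 2] \<open>0 < e\<close> by force
    qed measurable
    also have "\<dots> \<le> expectation (\<lambda>\<omega>. (norm (sample_mean V n \<omega> - m))\<^sup>2) / e\<^sup>2"
      by (rule integral_Markov_inequality_measure[OF sample_mean_sq_integrable sets.empty_sets])
        (use \<open>0 < e\<close> in simp_all)
    also have "\<dots> \<le> CARD('q) * (2 * B)\<^sup>2 / real n / e\<^sup>2"
      using expectation_sample_mean_sq_le[OF that] by (intro divide_right_mono) auto
    finally show ?thesis .
  qed
  then have upper: "\<forall>\<^sub>F n in sequentially. prob {\<omega> \<in> space M. e < dist (sample_mean V n \<omega>) m} \<le>
      CARD('q) * (2 * B)\<^sup>2 / real n / e\<^sup>2"
    by (rule eventually_mono[OF eventually_gt_at_top[of 0]])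
  show "(\<lambda>n. prob {\<omega> \<in> space M. e < dist (sample_mean V n \<omega>) m}) \<longlonglongrightarrow> 0"
    by (rule tendsto_sandwich[OF _ upper tendsto_const lim]) simp
qed

definition cov :: "real ^ 'q ^ 'q"
  where "cov = (\<chi> i j. covariance M (\<lambda>\<omega>. V 0 \<omega> $ i) (\<lambda>\<omega>. V 0 \<omega> $ j))"

text \<open>Serves both to see that the limiting covariance is positive semidefinite and to identify
  the variance in the scalar central limit theorem.\<close>

lemma cov_quadratic_form: "u \<bullet> (cov *v u) = expectation (\<lambda>\<omega>. (u \<bullet> (V n \<omega> - m))\<^sup>2)"
proof -
  have cov_nth: "cov $ i $ j = expectation (\<lambda>\<omega>. (V 0 \<omega> $ i - m $ i) * (V 0 \<omega> $ j - m $ j))" for i j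
    by (simp add: cov_def covariance_def expectation_component)
  have int: "integrable M (\<lambda>\<omega>. (V 0 \<omega> $ i - m $ i) * (V 0 \<omega> $ j - m $ j))" for i j
  proof (rule integrable_const_bound)
    have "\<bar>V 0 \<omega> $ i - m $ i\<bar> \<le> 2 * B" for \<omega> i
      using component_le[of 0 \<omega> i] mean_component_le[of i] by linarith
    then show "AE \<omega> in M. norm ((V 0 \<omega> $ i - m $ i) * (V 0 \<omega> $ j - m $ j)) \<le> (2 * B) * (2 * B)"
      unfolding real_norm_def abs_mult by (intro AE_I2 mult_mono') auto
  qed measurable
  have "expectation (\<lambda>\<omega>. (u \<bullet> (V n \<omega> - m))\<^sup>2) = expectation (\<lambda>\<omega>. (u \<bullet> (V 0 \<omega> - m))\<^sup>2)"
    by (rule expectation_compose) measurable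
  also have "\<dots> = expectation (\<lambda>\<omega>. \<Sum>i\<in>UNIV. \<Sum>j\<in>UNIV. u $ i * u $ j * ((V 0 \<omega> $ i - m $ i) * (V 0 \<omega> $ j - m $ j)))"
    by (simp add: inner_vec_def power2_eq_square sum_product mult_ac)
  also have "\<dots> = (\<Sum>i\<in>UNIV. \<Sum>j\<in>UNIV. u $ i * u $ j * cov $ i $ j)"
    by (simp add: int cov_nth)
  also have "\<dots> = u \<bullet> (cov *v u)"
    by (simp add: inner_vec_def matrix_vector_mult_def sum_distrib_left mult_ac)
  finally show ?thesis by simp
qed

section \<open>The delta method\<close>

theorem delta_method:
  fixes h :: "real ^ 'q \<Rightarrow> real ^ 'k" and H :: "real ^ 'q ^ 'k"
  assumes cont: "continuous_on UNIV h" and deriv: "(h has_derivative (\<lambda>x. H *v x)) (at m)"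
  shows "\<exists>N. is_normal N 0 (H ** cov ** transpose H) \<and>
    converges_in_law M (\<lambda>n \<omega>. sqrt (real n) *\<^sub>R (h (sample_mean V n \<omega>) - h m)) N"
proof -
  define S where "S = H ** cov ** transpose H"
  define Y where "Y n \<omega> = sqrt (real n) *\<^sub>R (h (sample_mean V n \<omega>) - h m)" for n \<omega>
  define R where "R x = h x - h m - H *v (x - m)" for x
  define D where "D = CARD('q) * (2 * B)\<^sup>2"
  have [measurable]: "h \<in> borel_measurable borel"
    using cont by (rule borel_measurable_continuous_onI)
  have inner: "t \<bullet> (H *v x) = (transpose H *v t) \<bullet> x" for t x
    using dot_lmul_matrix[of t H x] by simp
  have quad: "t \<bullet> (S *v t) = expectation (\<lambda>\<omega>. ((transpose H *v t) \<bullet> (V n \<omega> - m))\<^sup>2)" for t n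
    unfolding cov_quadratic_form[of _ n, symmetric]
    unfolding S_def matrix_vector_mul_assoc[symmetric] inner ..
  have "transpose cov = cov"
    by (simp add: transpose_def cov_def covariance_def mult.commute)
  then have sym: "transpose S = S"
    by (simp only: S_def matrix_transpose_mul transpose_transpose matrix_mul_assoc)
  have psd: "0 \<le> t \<bullet> (S *v t)" for t
    by (simp add: quad[of t 0])
  obtain N where N: "is_normal N 0 S" "prob_space N" "sets N = sets borel"
    and char_N: "\<And>t. (CLINT x|N. iexp (t \<bullet> x)) = exp (- (t \<bullet> (S *v t)) / 2)"
    using normal_exists[OF sym psd] by metis
  have Y_meas [measurable]: "Y n \<in> borel_measurable M" for n
    unfolding Y_def by measurable
  have char: "(\<lambda>n. CLINT x|distr M borel (Y n). iexp (t \<bullet> x)) \<longlonglongrightarrow> (CLINT x|N. iexp (t \<bullet> x))" for t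
  proof -
    \<comment> \<open>The linear part of \<open>t \<bullet> Y n\<close> is the normalised sum of
      these scalars once \<open>H\<close> is moved to the other side of the inner product.\<close>
    define Z where "Z k \<omega> = (transpose H *v t) \<bullet> (V k \<omega> - m)" for k \<omega>
    have Z_meas [measurable]: "Z k \<in> borel_measurable M" for k
      unfolding Z_def by measurable
    have Z_le: "\<bar>Z k \<omega>\<bar> \<le> norm (transpose H *v t) * (B + norm m)" for k \<omega>
    proof -
      have "norm (V k \<omega> - m) \<le> B + norm m"
        using norm_triangle_ineq4[of "V k \<omega>" m] bound[of k \<omega>] by linarith
      then show ?thesis
        unfolding Z_def by (intro order_trans[OF Cauchy_Schwarz_ineq2] mult_left_mono) simp_all
    qed
    have Z_distr: "distr M borel (Z k) = distr \<mu> borel (\<lambda>x. (transpose H *v t) \<bullet> (x - m))" for k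
      unfolding distr[of k, symmetric] by (subst distr_distr) (auto simp: comp_def Z_def[abs_def])
    have "(\<lambda>n. CLINT \<omega>|M. iexp ((\<Sum>k=1..n. Z k \<omega>) / sqrt (real n))) \<longlonglongrightarrow> exp (- (t \<bullet> (S *v t)) / 2)"
    proof (rule clt_char[OF _ _ _ _ Z_distr])
      show "indep_vars (\<lambda>_. borel) Z UNIV"
        unfolding Z_def by (rule indep_vars_compose2[OF indep]) measurable
      show "expectation (Z n) = 0" for n
        by (simp add: Z_def[abs_def] inner_vec_def expectation_component prob_space)
      show "expectation (\<lambda>\<omega>. (Z n \<omega>)\<^sup>2) = t \<bullet> (S *v t)" for n
        unfolding quad[of t n] Z_def ..
      have "(Z n \<omega>)\<^sup>2 \<le> (norm (transpose H *v t) * (B + norm m))\<^sup>2" for n \<omega>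
        using power_mono[OF Z_le[of n \<omega>], of 2] by simp
      then show "integrable M (\<lambda>\<omega>. (Z n \<omega>)\<^sup>2)" for n
        by (intro integrable_const_bound[where B="(norm (transpose H *v t) * (B + norm m))\<^sup>2"]) auto
    qed
    moreover have "(\<lambda>n. (CLINT \<omega>|M. iexp (t \<bullet> Y n \<omega>)) -
        (CLINT \<omega>|M. iexp ((\<Sum>k=1..n. Z k \<omega>) / sqrt (real n)))) \<longlonglongrightarrow> 0"
    proof (rule LIMSEQ_I)
      fix r :: real assume "0 < r"
      \<comment> \<open>Chosen so that \<open>norm t * (e * (1 + D))\<close> is at most
        \<open>r / 2\<close> for all \<open>n\<close>; the summand 1 in \<open>norm t + 1\<close>
        allows \<open>t = 0\<close>. The part with \<open>C\<close>, which depends on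
        \<open>e\<close>, is made small afterwards by taking \<open>n\<close> large.\<close>
      define e where "e = r / 2 / (norm t + 1) / (1 + D)"
      have "0 \<le> D" by (simp add: D_def)
      then have "0 < e" using \<open>0 < r\<close> by (simp add: e_def add_nonneg_pos add_pos_nonneg)
      obtain C where "0 \<le> C" and C: "\<And>x. norm x \<le> B \<Longrightarrow> norm (R x) \<le> e * norm (x - m) + C * (norm (x - m))\<^sup>2"
        using has_derivative_remainder_le[OF cont deriv \<open>0 < e\<close>, of B] unfolding R_def by metis
      have diff: "norm ((CLINT \<omega>|M. iexp (t \<bullet> Y n \<omega>)) -
          (CLINT \<omega>|M. iexp ((\<Sum>k=1..n. Z k \<omega>) / sqrt (real n)))) \<le>
          norm t * (e * (1 + D) + C * D / sqrt (real n))" if "0 < n" for n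
      proof -
        let ?x = "\<lambda>\<omega>. sample_mean V n \<omega>"
        have n: "sqrt (real n) * sqrt (real n) = real n" "0 < sqrt (real n)" using that by simp_all
        have Z_sum: "(\<Sum>k=1..n. Z k \<omega>) / sqrt (real n) = sqrt (real n) * (t \<bullet> (H *v (?x \<omega> - m)))" for \<omega>
        proof -
          have "(\<Sum>k=1..n. Z k \<omega>) = (transpose H *v t) \<bullet> ((\<Sum>k=1..n. V k \<omega>) - real n *\<^sub>R m)"
            by (simp add: Z_def inner_diff_right sum_subtractf inner_sum_right)
          also have "(\<Sum>k=1..n. V k \<omega>) - real n *\<^sub>R m = real n *\<^sub>R (?x \<omega> - m)"
            using that by (simp add: sample_mean_def scaleR_diff_right)
          finally show ?thesis
            by (simp only: inner inner_scaleR_right times_divide_eq_left[symmetric] real_div_sqrt of_nat_0_le_iff)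
        qed
        have pointwise: "\<bar>t \<bullet> Y n \<omega> - (\<Sum>k=1..n. Z k \<omega>) / sqrt (real n)\<bar> \<le>
            norm t * (e * (1 + real n * (norm (?x \<omega> - m))\<^sup>2) + C * sqrt (real n) * (norm (?x \<omega> - m))\<^sup>2)" for \<omega>
        proof -
          let ?d = "norm (?x \<omega> - m)"
          have "t \<bullet> Y n \<omega> - (\<Sum>k=1..n. Z k \<omega>) / sqrt (real n) = t \<bullet> (sqrt (real n) *\<^sub>R R (?x \<omega>))"
            unfolding Z_sum by (simp add: Y_def R_def inner_diff_right algebra_simps)
          then have "\<bar>t \<bullet> Y n \<omega> - (\<Sum>k=1..n. Z k \<omega>) / sqrt (real n)\<bar> \<le> norm t * (sqrt (real n) * norm (R (?x \<omega>)))"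
            using Cauchy_Schwarz_ineq2[of t "sqrt (real n) *\<^sub>R R (?x \<omega>)"] by simp
          also have "\<dots> \<le> norm t * (e * (1 + real n * ?d\<^sup>2) + C * sqrt (real n) * ?d\<^sup>2)"
          proof (rule mult_left_mono)
            have "sqrt (real n) * norm (R (?x \<omega>)) \<le> sqrt (real n) * (e * ?d + C * ?d\<^sup>2)"
              by (intro mult_left_mono C norm_sample_mean_le bound) simp
            moreover have "\<dots> = e * (sqrt (real n) * ?d) + C * sqrt (real n) * ?d\<^sup>2"
              by (simp add: algebra_simps)
            \<comment> \<open>The inequality of \<open>s\<close> with \<open>1 + s\<^sup>2\<close>
              replaces the first moment of the scaled error by its second moment, which is bounded
              by \<open>D\<close> uniformly in \<open>n\<close>.\<close>
            moreover have "e * (sqrt (real n) * ?d) \<le> e * (1 + real n * ?d\<^sup>2)"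
            proof (rule mult_left_mono)
              have "0 \<le> (sqrt (real n) * ?d - 1)\<^sup>2" "0 \<le> sqrt (real n) * ?d"
                by simp_all
              moreover have "(sqrt (real n) * ?d - 1)\<^sup>2 = real n * ?d\<^sup>2 - 2 * (sqrt (real n) * ?d) + 1"
                by (simp add: power2_diff power_mult_distrib)
              ultimately show "sqrt (real n) * ?d \<le> 1 + real n * ?d\<^sup>2" by linarith
            qed (use \<open>0 < e\<close> in simp)
            ultimately show "sqrt (real n) * norm (R (?x \<omega>)) \<le> e * (1 + real n * ?d\<^sup>2) + C * sqrt (real n) * ?d\<^sup>2"
              by linarith
          qed simp
          finally show ?thesis .
        qed
        define E2 where "E2 = expectation (\<lambda>\<omega>. (norm (?x \<omega> - m))\<^sup>2)"
        have E2: "E2 \<le> D / real n"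
          using expectation_sample_mean_sq_le[OF that] by (simp add: E2_def D_def)
        have int: "integrable M (\<lambda>\<omega>. norm t * (e * (1 + real n * (norm (?x \<omega> - m))\<^sup>2) +
            C * sqrt (real n) * (norm (?x \<omega> - m))\<^sup>2))"
          by (intro integrable_mult_right Bochner_Integration.integrable_add integrable_const
              sample_mean_sq_integrable)
        have "norm ((CLINT \<omega>|M. iexp (t \<bullet> Y n \<omega>)) - (CLINT \<omega>|M. iexp ((\<Sum>k=1..n. Z k \<omega>) / sqrt (real n)))) \<le>
            expectation (\<lambda>\<omega>. norm t * (e * (1 + real n * (norm (?x \<omega> - m))\<^sup>2) +
              C * sqrt (real n) * (norm (?x \<omega> - m))\<^sup>2))"
          by (rule norm_char_diff_le[OF _ _ int pointwise]) measurable
        moreover have "expectation (\<lambda>\<omega>. norm t * (e * (1 + real n * (norm (?x \<omega> - m))\<^sup>2) +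
              C * sqrt (real n) * (norm (?x \<omega> - m))\<^sup>2)) = norm t * (e * (1 + real n * E2) + C * sqrt (real n) * E2)"
          using sample_mean_sq_integrable[of n] by (simp add: prob_space E2_def)
        moreover have "norm t * (e * (1 + real n * E2) + C * sqrt (real n) * E2) \<le>
            norm t * (e * (1 + D) + C * D / sqrt (real n))"
        proof -
          have "real n * (D / real n) = D" "C * sqrt (real n) * (D / real n) = C * D / sqrt (real n)"
            using that n by (simp_all add: field_simps)
          moreover have "norm t * (e * (1 + real n * E2) + C * sqrt (real n) * E2) \<le>
              norm t * (e * (1 + real n * (D / real n)) + C * sqrt (real n) * (D / real n))"
            using E2 \<open>0 < e\<close> \<open>0 \<le> C\<close> by (intro mult_left_mono add_mono order_refl) auto
          ultimately show ?thesis by (simp only:)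
        qed
        ultimately show ?thesis by linarith
      qed
      have "(\<lambda>n. norm t * (C * D * inverse (sqrt (real n)))) \<longlonglongrightarrow> norm t * (C * D * 0)"
        by (intro tendsto_mult tendsto_const tendsto_inverse_0_at_top
            filterlim_compose[OF sqrt_at_top filterlim_real_sequentially])
      then have "(\<lambda>n. norm t * (C * D * inverse (sqrt (real n)))) \<longlonglongrightarrow> 0"
        unfolding mult_zero_right .
      from LIMSEQ_D[OF this, of "r / 2"] obtain n0 where
        n0: "\<And>n. n \<ge> n0 \<Longrightarrow> \<bar>norm t * (C * D * inverse (sqrt (real n)))\<bar> < r / 2"
        using \<open>0 < r\<close> unfolding diff_zero real_norm_def by (meson half_gt_zero)
      have "norm t * (e * (1 + D)) \<le> r / 2"
      proof -
        have "e * (1 + D) = r / 2 / (norm t + 1)"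
          using \<open>0 \<le> D\<close> by (simp add: e_def)
        then have "norm t * (e * (1 + D)) = r / 2 * (norm t / (norm t + 1))" by simp
        also have "\<dots> \<le> r / 2 * 1"
          using \<open>0 < r\<close> divide_le_eq_1_pos[of "norm t + 1" "norm t"] norm_ge_zero[of t]
          by (intro mult_left_mono) linarith+
        finally show ?thesis by simp
      qed
      have "norm ((CLINT \<omega>|M. iexp (t \<bullet> Y n \<omega>)) -
          (CLINT \<omega>|M. iexp ((\<Sum>k=1..n. Z k \<omega>) / sqrt (real n))) - 0) < r" if n: "max 1 n0 \<le> n" for n
      proof -
        have "norm t * (e * (1 + D) + C * D / sqrt (real n)) =
            norm t * (e * (1 + D)) + norm t * (C * D * inverse (sqrt (real n)))"
          by (simp only: divide_inverse distrib_left)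
        then show ?thesis
          using diff[of n] n0[of n] n \<open>norm t * (e * (1 + D)) \<le> r / 2\<close> unfolding diff_zero by linarith
      qed
      then show "\<exists>n0. \<forall>n\<ge>n0. norm ((CLINT \<omega>|M. iexp (t \<bullet> Y n \<omega>)) -
          (CLINT \<omega>|M. iexp ((\<Sum>k=1..n. Z k \<omega>) / sqrt (real n))) - 0) < r" by blast
    qed
    ultimately have "(\<lambda>n. CLINT \<omega>|M. iexp (t \<bullet> Y n \<omega>)) \<longlonglongrightarrow> exp (- (t \<bullet> (S *v t)) / 2)"
      by (rule Lim_transform)
    then show ?thesis
      by (simp only: char_N) (simp add: integral_distr)
  qed
  have "converges_in_law M Y N"
    unfolding converges_in_law_def
    using levy_continuity_euclidean[OF prob_space_distr[OF Y_meas] sets_distr N(2,3) char] by blast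
  with N(1) show ?thesis
    unfolding S_def Y_def by blast
qed

end

section \<open>Convergence in probability\<close>

lemma (in prob_space) converges_in_prob_continuous:
  fixes A :: "nat \<Rightarrow> 'a \<Rightarrow> 'b::{metric_space, second_countable_topology}" and F :: "'b \<Rightarrow> 'c::metric_space"
  assumes A: "converges_in_prob M A a" and [measurable]: "\<And>n. A n \<in> borel_measurable M"
    and F: "isCont F a"
  shows "converges_in_prob M (\<lambda>n \<omega>. F (A n \<omega>)) (F a)"
  unfolding converges_in_prob_def
proof (intro allI impI)
  fix e :: real assume "0 < e"
  then obtain d where "0 < d" and d: "\<And>x. dist x a < d \<Longrightarrow> dist (F x) (F a) < e"
    using F unfolding continuous_at_eps_delta by blast
  \<comment> \<open>Halving \<open>d\<close> turns a distance of at least \<open>d\<close> into the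
    strict inequality in \<open>converges_in_prob\<close>.\<close>
  have lim: "(\<lambda>n. prob {\<omega> \<in> space M. d / 2 < dist (A n \<omega>) a}) \<longlonglongrightarrow> 0"
    using A half_gt_zero[OF \<open>0 < d\<close>] unfolding converges_in_prob_def by blast
  have "prob {\<omega> \<in> space M. e < dist (F (A n \<omega>)) (F a)} \<le> prob {\<omega> \<in> space M. d / 2 < dist (A n \<omega>) a}" for n
  proof (rule finite_measure_mono)
    show "{\<omega> \<in> space M. e < dist (F (A n \<omega>)) (F a)} \<subseteq> {\<omega> \<in> space M. d / 2 < dist (A n \<omega>) a}"
    proof clarify
      fix \<omega> assume "e < dist (F (A n \<omega>)) (F a)"
      then have "\<not> dist (A n \<omega>) a < d" using d[of "A n \<omega>"] by linarith
      then show "d / 2 < dist (A n \<omega>) a" using \<open>0 < d\<close> by linarith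
    qed
  qed measurable
  then show "(\<lambda>n. prob {\<omega> \<in> space M. e < dist (F (A n \<omega>)) (F a)}) \<longlonglongrightarrow> 0"
    by (intro tendsto_sandwich[OF always_eventually always_eventually tendsto_const lim] allI measure_nonneg)
qed

lemma (in prob_space) converges_in_prob_Pair:
  fixes A :: "nat \<Rightarrow> 'a \<Rightarrow> 'b::{metric_space, second_countable_topology}"
    and C :: "nat \<Rightarrow> 'a \<Rightarrow> 'c::{metric_space, second_countable_topology}"
  assumes A: "converges_in_prob M A a" and [measurable]: "\<And>n. A n \<in> borel_measurable M"
    and C: "converges_in_prob M C c" and [measurable]: "\<And>n. C n \<in> borel_measurable M"
  shows "converges_in_prob M (\<lambda>n \<omega>. (A n \<omega>, C n \<omega>)) (a, c)"
  unfolding converges_in_prob_def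
proof (intro allI impI)
  fix e :: real assume "0 < e"
  have "(\<lambda>n. prob {\<omega> \<in> space M. e / 2 < dist (A n \<omega>) a} + prob {\<omega> \<in> space M. e / 2 < dist (C n \<omega>) c}) \<longlonglongrightarrow> 0 + 0"
    using A C half_gt_zero[OF \<open>0 < e\<close>] unfolding converges_in_prob_def by (intro tendsto_add) blast+
  then have lim: "(\<lambda>n. prob {\<omega> \<in> space M. e / 2 < dist (A n \<omega>) a} +
      prob {\<omega> \<in> space M. e / 2 < dist (C n \<omega>) c}) \<longlonglongrightarrow> 0" by simp
  have "prob {\<omega> \<in> space M. e < dist (A n \<omega>, C n \<omega>) (a, c)} \<le>
      prob {\<omega> \<in> space M. e / 2 < dist (A n \<omega>) a} + prob {\<omega> \<in> space M. e / 2 < dist (C n \<omega>) c}" for n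
  proof -
    have "prob {\<omega> \<in> space M. e < dist (A n \<omega>, C n \<omega>) (a, c)} \<le>
        prob ({\<omega> \<in> space M. e / 2 < dist (A n \<omega>) a} \<union> {\<omega> \<in> space M. e / 2 < dist (C n \<omega>) c})"
    proof (rule finite_measure_mono)
      show "{\<omega> \<in> space M. e < dist (A n \<omega>, C n \<omega>) (a, c)} \<subseteq>
          {\<omega> \<in> space M. e / 2 < dist (A n \<omega>) a} \<union> {\<omega> \<in> space M. e / 2 < dist (C n \<omega>) c}"
      proof
        fix \<omega> assume \<omega>: "\<omega> \<in> {\<omega> \<in> space M. e < dist (A n \<omega>, C n \<omega>) (a, c)}"
        have "dist (A n \<omega>, C n \<omega>) (a, c) \<le> dist (A n \<omega>) a + dist (C n \<omega>) c"
          unfolding dist_Pair_Pair by (rule sqrt_sum_squares_le_sum) simp_all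
        with \<omega> have "e / 2 < dist (A n \<omega>) a \<or> e / 2 < dist (C n \<omega>) c" "\<omega> \<in> space M"
          by auto
        then show "\<omega> \<in> {\<omega> \<in> space M. e / 2 < dist (A n \<omega>) a} \<union> {\<omega> \<in> space M. e / 2 < dist (C n \<omega>) c}"
          by blast
      qed
    qed measurable
    also have "\<dots> \<le> prob {\<omega> \<in> space M. e / 2 < dist (A n \<omega>) a} + prob {\<omega> \<in> space M. e / 2 < dist (C n \<omega>) c}"
      by (rule measure_Un_le) measurable
    finally show ?thesis .
  qed
  then show "(\<lambda>n. prob {\<omega> \<in> space M. e < dist (A n \<omega>, C n \<omega>) (a, c)}) \<longlonglongrightarrow> 0"
    by (intro tendsto_sandwich[OF always_eventually always_eventually tendsto_const lim] allI measure_nonneg)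
qed

text \<open>Lets the factor \<open>n / (n - 1)\<close> enter as one more coordinate in the
  continuous mapping argument.\<close>

lemma (in prob_space) converges_in_prob_deterministic:
  assumes "a \<longlonglongrightarrow> l"
  shows "converges_in_prob M (\<lambda>n _. a n) l"
  unfolding converges_in_prob_def
proof (intro allI impI)
  fix e :: real assume "0 < e"
  with assms have "\<forall>\<^sub>F n in sequentially. dist (a n) l < e" by (rule tendstoD)
  then show "(\<lambda>n. prob {\<omega> \<in> space M. e < dist (a n) l}) \<longlonglongrightarrow> 0"
    by (intro tendsto_eventually, elim eventually_mono) simp
qed

section \<open>The Jacobian of the centred moments\<close>

lemma has_derivative_vec_lambda:
  fixes f :: "'n::finite \<Rightarrow> 'b::real_normed_vector \<Rightarrow> real"
  assumes "\<And>i. (f i has_derivative f' i) (at x)"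
  shows "((\<lambda>y. \<chi> i. f i y) has_derivative (\<lambda>v. \<chi> i. f' i v)) (at x)"
proof -
  have vec: "(\<chi> i. g i) = (\<Sum>i\<in>UNIV. g i *\<^sub>R axis i 1)" for g :: "'n \<Rightarrow> real"
    by (simp add: vec_eq_iff axis_def if_distrib cong: if_cong)
  show ?thesis
    unfolding vec by (intro has_derivative_sum has_derivative_scaleR_left assms)
qed

definition moment_coord_deriv :: "('q::finite \<Rightarrow> nat) \<Rightarrow> nat \<Rightarrow> real ^ 'q \<Rightarrow> real"
  where "moment_coord_deriv ord j v = (if j = 0 then 0 else v $ inv ord j)"

text \<open>The product rule, summand by summand. At \<open>j = c k\<close> the truncated exponent
  \<open>c k - j - 1\<close> is 0, and the factor \<open>real (c k - j)\<close> removes that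
  term.\<close>

definition centred_moments_deriv ::
    "('q::finite \<Rightarrow> nat) \<Rightarrow> ('k::finite \<Rightarrow> nat) \<Rightarrow> real ^ 'q \<Rightarrow> real ^ 'q \<Rightarrow> real ^ 'k"
  where "centred_moments_deriv ord c p v = (\<chi> k. \<Sum>j=0..c k. real (c k choose j) *
    (real (c k - j) * (- moment_coord ord p 1) ^ (c k - j - 1) * (- moment_coord_deriv ord 1 v) *
       moment_coord ord p j +
     (- moment_coord ord p 1) ^ (c k - j) * moment_coord_deriv ord j v))"

lemma has_derivative_moment_coord:
  "((\<lambda>p. moment_coord ord p j) has_derivative moment_coord_deriv ord j) (at p)"
proof (cases "j = 0")
  case False
  have "((\<lambda>p. p $ inv ord j) has_derivative (\<lambda>v. v $ inv ord j)) (at p)"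
    by (rule bounded_linear_imp_has_derivative[OF bounded_linear_vec_nth])
  then show ?thesis
    using False by (simp add: moment_coord_def moment_coord_deriv_def[abs_def])
qed (simp add: moment_coord_def moment_coord_deriv_def[abs_def])

lemma has_derivative_centred_moments:
  "(centred_moments ord c has_derivative centred_moments_deriv ord c p) (at p)"
  unfolding centred_moments_def[abs_def] centred_moments_deriv_def[abs_def]
proof (intro has_derivative_vec_lambda has_derivative_sum)
  fix k j
  show "((\<lambda>p. real (c k choose j) * (- moment_coord ord p 1) ^ (c k - j) * moment_coord ord p j)
      has_derivative (\<lambda>v. real (c k choose j) *
        (real (c k - j) * (- moment_coord ord p 1) ^ (c k - j - 1) * (- moment_coord_deriv ord 1 v) *
           moment_coord ord p j +
         (- moment_coord ord p 1) ^ (c k - j) * moment_coord_deriv ord j v))) (at p)"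
    by (rule derivative_eq_intros has_derivative_moment_coord refl)+ (simp add: algebra_simps)
qed

lemma jacobian_centred_moments:
  "jacobian (centred_moments ord c) (at p) = matrix (centred_moments_deriv ord c p)"
  unfolding jacobian_def frechet_derivative_at[OF has_derivative_centred_moments] ..

lemma has_derivative_jacobian_centred_moments:
  "(centred_moments ord c has_derivative (\<lambda>v. jacobian (centred_moments ord c) (at p) *v v)) (at p)"
  by (rule jacobian_works[THEN iffD1, OF differentiableI[OF has_derivative_centred_moments]])

lemma continuous_centred_moments: "continuous_on UNIV (centred_moments ord c)"
  by (intro continuous_at_imp_continuous_on ballI has_derivative_continuous[OF has_derivative_centred_moments])

lemma continuous_moment_coord [continuous_intros]:
  assumes "continuous_on S f"
  shows "continuous_on S (\<lambda>x. moment_coord ord (f x) j)"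
  using assms by (cases "j = 0") (simp_all add: moment_coord_def continuous_on_component)

text \<open>The entries of the explicit derivative are polynomials in \<open>p\<close>. This
  continuity makes the plug-in Jacobian consistent.\<close>

lemma continuous_jacobian_centred_moments:
  "continuous_on UNIV (\<lambda>p. jacobian (centred_moments ord c) (at p))"
  unfolding jacobian_centred_moments matrix_def centred_moments_deriv_def
  by (intro continuous_intros)

lemma continuous_on_matrix_mult:
  fixes A :: "'b::topological_space \<Rightarrow> real ^ 'n ^ 'm" and B :: "'b \<Rightarrow> real ^ 'l ^ 'n"
  assumes "continuous_on S A" and "continuous_on S B"
  shows "continuous_on S (\<lambda>x. A x ** B x)"
  unfolding matrix_matrix_mult_def by (intro continuous_intros assms)

lemma continuous_on_matrix_transpose:
  fixes A :: "'b::topological_space \<Rightarrow> real ^ 'n ^ 'm"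
  assumes "continuous_on S A"
  shows "continuous_on S (\<lambda>x. transpose (A x))"
  unfolding transpose_def by (intro continuous_intros assms)

section \<open>Sample moments\<close>

text \<open>Expanding the product exhibits the sample covariance as \<open>n / (n - 1)\<close> times
  a polynomial in sample means, to which the law of large numbers applies.\<close>

lemma sum_centred_products:
  fixes f g :: "nat \<Rightarrow> real"
  shows "(\<Sum>k=1..n. (f k - 1 / real n * sum f {1..n}) * (g k - 1 / real n * sum g {1..n})) =
    real n * (1 / real n * (\<Sum>k=1..n. f k * g k) - 1 / real n * sum f {1..n} * (1 / real n * sum g {1..n}))"
proof (cases "n = 0")
  case False
  define a b where "a = 1 / real n * sum f {1..n}" and "b = 1 / real n * sum g {1..n}"
  have "sum f {1..n} = real n * a" "sum g {1..n} = real n * b"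
    using False by (simp_all add: a_def b_def)
  moreover have "(\<Sum>k=1..n. (f k - a) * (g k - b)) =
      (\<Sum>k=1..n. f k * g k) - a * sum g {1..n} - b * sum f {1..n} + real n * (a * b)"
    by (simp add: algebra_simps sum.distrib sum_subtractf sum_distrib_left)
  ultimately show ?thesis
    using False unfolding a_def[symmetric] b_def[symmetric] by (simp add: algebra_simps)
qed simp

lemma borel_measurable_transform:
  assumes "is_interval I" and "continuous_on I G"
  shows "transform G I \<in> borel_measurable borel"
proof -
  have "I \<in> sets borel"
    using assms(1) is_real_interval[of I] by auto
  then have "(\<lambda>x. if x \<in> I then G x else 0) \<in> borel_measurable borel"
    using borel_measurable_continuous_on_if[of I G "\<lambda>_. 0"] assms(2) by simp
  then show ?thesis by (simp add: transform_def[abs_def])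
qed

lemma (in prob_space) covariance_eq:
  assumes "integrable M Y" and "integrable M Z" and "integrable M (\<lambda>\<omega>. Y \<omega> * Z \<omega>)"
  shows "covariance M Y Z = expectation (\<lambda>\<omega>. Y \<omega> * Z \<omega>) - expectation Y * expectation Z"
proof -
  have "covariance M Y Z = expectation (\<lambda>\<omega>. Y \<omega> * Z \<omega> - expectation Z * Y \<omega> - expectation Y * Z \<omega> +
      expectation Y * expectation Z)"
    unfolding covariance_def by (simp add: algebra_simps)
  then show ?thesis
    using assms by (simp add: prob_space)
qed

lemma (in prob_space) bounded_iid_compose:
  fixes X :: "nat \<Rightarrow> 'a \<Rightarrow> real" and \<phi> :: "real \<Rightarrow> real ^ 'q"
  assumes indep: "indep_vars (\<lambda>_. borel) X UNIV" and distr: "\<And>n. distr M borel (X n) = P"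
    and [measurable]: "\<phi> \<in> borel_measurable borel" and bound: "\<And>x. norm (\<phi> x) \<le> B"
  shows "bounded_iid M (\<lambda>n \<omega>. \<phi> (X n \<omega>)) B (distr P borel \<phi>) (\<chi> i. expectation (\<lambda>\<omega>. \<phi> (X 0 \<omega>) $ i))"
proof unfold_locales
  have [measurable]: "X n \<in> borel_measurable M" for n
    using indep by (auto simp: indep_vars_def2)
  show "indep_vars (\<lambda>_. borel) (\<lambda>n \<omega>. \<phi> (X n \<omega>)) UNIV"
    by (rule indep_vars_compose2[OF indep]) measurable
  show "distr M borel (\<lambda>\<omega>. \<phi> (X n \<omega>)) = distr P borel \<phi>" for n
    unfolding distr[of n, symmetric] by (subst distr_distr) (auto simp: comp_def)
qed (simp_all add: bound)

lemma norm_vec_lambda_le: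
  fixes f :: "'n::finite \<Rightarrow> real"
  assumes "\<And>i. \<bar>f i\<bar> \<le> 1"
  shows "norm (\<chi> i. f i) \<le> CARD('n)"
  using norm_le_l1_cart[of "\<chi> i. f i"] sum_mono[of UNIV "\<lambda>i. \<bar>f i\<bar>" "\<lambda>_. 1"] assms by simp

(* The i.i.d. family X 0, X 1, X 2, ... consists of the generic copy X = X 0 followed by the
   sample X_1, X_2, ...; likewise U 0 is U and U i is U_i for i \<ge> 1. *)
theorem corollary6p4:
  fixes I :: "real set" and G :: "real \<Rightarrow> real"
    and M :: "'a measure" and P :: "real measure" and X :: "nat \<Rightarrow> 'a \<Rightarrow> real"
    and q :: nat and ord :: "'q::finite \<Rightarrow> nat" and c :: "'k::finite \<Rightarrow> nat"
  assumes "is_interval I" and "continuous_on I G" and "strict_mono_on I G"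
    and "bij_betw G I {0<..<1}"
    and "prob_space M"
    and "prob_space.indep_vars M (\<lambda>_. borel) X UNIV"
    and "\<And>i. distr M borel (X i) = P"
    and "measure P I = 1"
    and "q \<ge> 2" and "bij_betw ord (UNIV :: 'q set) {1..q}"
    and "\<And>k. 2 \<le> c k \<and> c k \<le> q"
  defines "U \<equiv> (\<lambda>i \<omega>. transform G I (X i \<omega>))"
  defines "p \<equiv> moment_vec M ord (U 0)"
    and "p_hat \<equiv> sample_moment_vec ord U"
    and "\<Sigma> \<equiv> moment_cov M ord (U 0)"
    and "\<Sigma>_hat \<equiv> sample_moment_cov ord U"
    and "h \<equiv> (centred_moments ord c :: real ^ 'q \<Rightarrow> real ^ 'k)"
  defines "H \<equiv> jacobian h (at p)"
    and "H_hat \<equiv> (\<lambda>n \<omega>. jacobian h (at (p_hat n \<omega>)))"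
  shows "(\<exists>N. is_normal N 0 (H ** \<Sigma> ** transpose H) \<and>
            converges_in_law M (\<lambda>n \<omega>. sqrt (real n) *\<^sub>R (h (p_hat n \<omega>) - h p)) N) \<and>
         converges_in_prob M
           (\<lambda>n \<omega>. H_hat n \<omega> ** \<Sigma>_hat n \<omega> ** transpose (H_hat n \<omega>))
           (H ** \<Sigma> ** transpose H)"
proof -
  interpret prob_space M by fact
  have [measurable]: "X n \<in> borel_measurable M" for n
    using assms(6) by (auto simp: indep_vars_def2)
  have transform_meas [measurable]: "transform G I \<in> borel_measurable borel"
    using assms(1,2) by (rule borel_measurable_transform)
  \<comment> \<open>The value 0 off \<open>I\<close> keeps these bounds true for every real
    \<open>x\<close>, so the pointwise bound in \<open>bounded_iid\<close> holds without exceptional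
    null sets.\<close>
  have U_bounds: "0 \<le> transform G I x" "transform G I x \<le> 1" for x
    using bij_betwE[OF assms(4)] by (auto simp: transform_def intro: less_imp_le)
  then have U_le: "\<bar>transform G I x ^ r\<bar> \<le> 1" for x r
    by (simp add: power_le_one)
  then have U_mult_le: "\<bar>transform G I x ^ r * transform G I x ^ s\<bar> \<le> 1" for x r s
    by (simp flip: power_add)
  define \<phi> :: "real \<Rightarrow> real ^ 'q" where "\<phi> x = (\<chi> i. transform G I x ^ ord i)" for x
  define \<psi> :: "real \<Rightarrow> real ^ ('q \<times> 'q)"
    where "\<psi> x = (\<chi> ij. transform G I x ^ ord (fst ij) * transform G I x ^ ord (snd ij))" for x
  have "(\<lambda>u. \<chi> i. u ^ ord i) \<in> borel_measurable (borel :: real measure)"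
    by (intro borel_measurable_continuous_onI continuous_intros)
  from measurable_compose[OF transform_meas this]
  have \<phi>_meas: "\<phi> \<in> borel_measurable borel" by (simp add: \<phi>_def[abs_def])
  have "(\<lambda>u. \<chi> ij. u ^ ord (fst ij) * u ^ ord (snd ij)) \<in> borel_measurable (borel :: real measure)"
    by (intro borel_measurable_continuous_onI continuous_intros)
  from measurable_compose[OF transform_meas this]
  have \<psi>_meas: "\<psi> \<in> borel_measurable borel" by (simp add: \<psi>_def[abs_def])
  have p: "p = (\<chi> i. expectation (\<lambda>\<omega>. \<phi> (X 0 \<omega>) $ i))"
    by (simp add: p_def moment_vec_def U_def \<phi>_def)
  define m2 :: "real ^ ('q \<times> 'q)" where "m2 = (\<chi> i. expectation (\<lambda>\<omega>. \<psi> (X 0 \<omega>) $ i))"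
  have "norm (\<phi> x) \<le> CARD('q)" for x
    unfolding \<phi>_def by (rule norm_vec_lambda_le) (rule U_le)
  then interpret V: bounded_iid M "\<lambda>n \<omega>. \<phi> (X n \<omega>)" "CARD('q)" "distr P borel \<phi>" p
    unfolding p by (rule bounded_iid_compose[OF assms(6) assms(7) \<phi>_meas])
  have "norm (\<psi> x) \<le> CARD('q \<times> 'q)" for x
    unfolding \<psi>_def by (rule norm_vec_lambda_le) (rule U_mult_le)
  then interpret W: bounded_iid M "\<lambda>n \<omega>. \<psi> (X n \<omega>)" "CARD('q \<times> 'q)" "distr P borel \<psi>" m2
    unfolding m2_def by (rule bounded_iid_compose[OF assms(6) assms(7) \<psi>_meas])
  have p_hat: "p_hat n \<omega> = sample_mean (\<lambda>k \<omega>. \<phi> (X k \<omega>)) n \<omega>" for n \<omega>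
    by (simp add: p_hat_def sample_moment_vec_def sample_mean_def U_def \<phi>_def vec_eq_iff)
  have \<Sigma>: "\<Sigma> = V.cov"
    unfolding \<Sigma>_def moment_cov_def V.cov_def by (simp add: U_def \<phi>_def)
  have "\<exists>N. is_normal N 0 (H ** \<Sigma> ** transpose H) \<and>
      converges_in_law M (\<lambda>n \<omega>. sqrt (real n) *\<^sub>R (h (p_hat n \<omega>) - h p)) N"
    unfolding p_hat \<Sigma> h_def H_def
    by (rule V.delta_method continuous_centred_moments has_derivative_jacobian_centred_moments)+
  moreover have "converges_in_prob M
      (\<lambda>n \<omega>. H_hat n \<omega> ** \<Sigma>_hat n \<omega> ** transpose (H_hat n \<omega>)) (H ** \<Sigma> ** transpose H)"
  proof -
    \<comment> \<open>The arguments are the mean of the powers, the mean of their products, and the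
      factor \<open>n / (n - 1)\<close>, whose limit is 1.\<close>
    define C :: "(real ^ 'q) \<times> (real ^ ('q \<times> 'q)) \<times> real \<Rightarrow> real ^ 'q ^ 'q"
      where "C y = (\<chi> i j. snd (snd y) * (fst (snd y) $ (i, j) - fst y $ i * fst y $ j))" for y
    define J where "J = (\<lambda>p. jacobian h (at p))"
    define F where "F y = J (fst y) ** C y ** transpose (J (fst y))" for y
    have "continuous_on UNIV (\<lambda>y :: (real ^ 'q) \<times> (real ^ ('q \<times> 'q)) \<times> real. J (fst y))"
      unfolding J_def h_def
      by (rule continuous_on_compose2[OF continuous_jacobian_centred_moments]) (auto intro: continuous_on_fst continuous_on_id)
    moreover have "continuous_on UNIV C"
      unfolding C_def by (intro continuous_intros)
    ultimately have "continuous_on UNIV F"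
      unfolding F_def by (intro continuous_on_matrix_mult continuous_on_matrix_transpose)
    then have F_cont: "isCont F y" for y
      using continuous_on_eq_continuous_at[OF open_UNIV] by blast
    \<comment> \<open>After a shift by one the sequence is \<open>Suc n / n\<close>; the vanishing
      denominator at \<open>n = 1\<close> does not affect the limit.\<close>
    have lim: "(\<lambda>n. real n / (real n - 1)) \<longlonglongrightarrow> 1"
      by (rule LIMSEQ_imp_Suc) (use LIMSEQ_Suc_n_over_n in simp)
    define Y where "Y n \<omega> = (sample_mean (\<lambda>k \<omega>. \<phi> (X k \<omega>)) n \<omega>,
      sample_mean (\<lambda>k \<omega>. \<psi> (X k \<omega>)) n \<omega>, real n / (real n - 1))" for n \<omega>
    have "converges_in_prob M Y (p, m2, 1)"
      unfolding Y_def
      by (intro converges_in_prob_Pair converges_in_prob_deterministic lim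
          V.sample_mean_converges_in_prob W.sample_mean_converges_in_prob
          V.sample_mean_measurable W.sample_mean_measurable borel_measurable_Pair borel_measurable_const)
    moreover have "Y n \<in> borel_measurable M" for n
      unfolding Y_def
      by (intro V.sample_mean_measurable W.sample_mean_measurable borel_measurable_Pair borel_measurable_const)
    ultimately have "converges_in_prob M (\<lambda>n \<omega>. F (Y n \<omega>)) (F (p, m2, 1))"
      using F_cont by (rule converges_in_prob_continuous)
    \<comment> \<open>An exact identity for every \<open>n\<close>: for \<open>n = 1\<close>
      division by zero makes both covariance matrices 0, and for \<open>n = 0\<close> the sums are
      empty.\<close>
    moreover have "F (Y n \<omega>) = H_hat n \<omega> ** \<Sigma>_hat n \<omega> ** transpose (H_hat n \<omega>)" for n \<omega>
    proof -
      have "C (Y n \<omega>) $ i $ j = \<Sigma>_hat n \<omega> $ i $ j" for i j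
      proof -
        let ?f = "\<lambda>i k. U k \<omega> ^ ord i"
        have "C (Y n \<omega>) $ i $ j = real n / (real n - 1) * (1 / real n * (\<Sum>k=1..n. ?f i k * ?f j k) -
            1 / real n * sum (?f i) {1..n} * (1 / real n * sum (?f j) {1..n}))"
          by (simp add: C_def Y_def sample_mean_def \<phi>_def \<psi>_def U_def)
        moreover have "\<Sigma>_hat n \<omega> $ i $ j = 1 / (real n - 1) * (\<Sum>k=1..n.
            (?f i k - 1 / real n * sum (?f i) {1..n}) * (?f j k - 1 / real n * sum (?f j) {1..n}))"
          by (simp add: \<Sigma>_hat_def sample_moment_cov_def sample_moment_vec_def)
        ultimately show ?thesis
          unfolding sum_centred_products by simp
      qed
      then have "C (Y n \<omega>) = \<Sigma>_hat n \<omega>" by (simp add: vec_eq_iff)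
      then show ?thesis
        by (simp add: F_def J_def H_hat_def p_hat Y_def)
    qed
    moreover have "F (p, m2, 1) = H ** \<Sigma> ** transpose H"
    proof -
      have "C (p, m2, 1) $ i $ j = \<Sigma> $ i $ j" for i j
      proof -
        have int: "integrable M (\<lambda>\<omega>. \<phi> (X 0 \<omega>) $ i)" for i
          by (rule V.component_integrable)
        have "(\<lambda>\<omega>. \<psi> (X 0 \<omega>) $ (i, j)) = (\<lambda>\<omega>. \<phi> (X 0 \<omega>) $ i * \<phi> (X 0 \<omega>) $ j)"
          by (simp add: \<phi>_def \<psi>_def)
        moreover have "integrable M (\<lambda>\<omega>. \<psi> (X 0 \<omega>) $ (i, j))"
          by (rule W.component_integrable)
        ultimately have "covariance M (\<lambda>\<omega>. \<phi> (X 0 \<omega>) $ i) (\<lambda>\<omega>. \<phi> (X 0 \<omega>) $ j) =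
            m2 $ (i, j) - p $ i * p $ j"
          using covariance_eq[OF int int, of i j] by (simp add: m2_def p)
        then show ?thesis
          unfolding \<Sigma> V.cov_def by (simp add: C_def)
      qed
      then have "C (p, m2, 1) = \<Sigma>" by (simp add: vec_eq_iff)
      then show ?thesis
        by (simp add: F_def J_def H_def)
    qed
    ultimately show ?thesis by simp
  qed
  ultimately show ?thesis ..
qed

end
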